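(* Let $d\ge2$ and consider the infinite color urn model with colors indexed by $\mathbb{Z}^d$ associated with the bounded increment random walk with increments $\{X_j\}_{j\ge1}$, and let $Z_n$ be the color of the $(n+1)$-th selected ball. Let $\mathcal{L}$ be the minimal lattice of $X_1$, let $l=\det(\mathcal{L})$, let $x_0$ be such that $\mathbb{P}(X_1\in x_0+\mathcal{L})=1$, and for $n\ge2$ define $$\mathcal{L}_n^{(d)}:=\left\{x: x=\frac{n}{\sqrt{\log n}}x_0\varSigma^{-1/2}-\sqrt{\log n}\,\mu\,\varSigma^{-1/2}+\frac{1}{\sqrt{\log n}}z\varSigma^{-1/2},\ z\in\mathcal{L}\right\}.$$ Assume that $\mathbb{P}[X_1=0]>0$. Then, as $n\to\infty$, $$\sup_{x\in\mathcal{L}_n^{(d)}}\left|\frac{\det(\varSigma^{1/2})\left(\sqrt{\log n}\right)^d}{l}\,\mathbb{P}\left(\frac{Z_n-\mu\log n}{\sqrt{\log n}}\varSigma^{-1/2}=x\right)-\phi_d(x)\right|\longrightarrow0.$$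
   Context: Vectors are row vectors; $x^T$ denotes the transpose. $\{X_j\}_{j\ge1}$ are i.i.d. random vectors in $\mathbb{Z}^d$ with probability mass function $p(u)=\mathbb{P}(X_1=u)$, and there is a finite non-empty $B\subseteq\mathbb{Z}^d$ with $p(u)=0$ for $u\notin B$. Put $\mu:=\mathbb{E}[X_1]$ and $\varSigma:=\mathbb{E}[X_1^TX_1]$ (a non-centered second moment matrix), assumed positive definite; $\varSigma^{1/2}$ is its unique positive definite square root and $\varSigma^{-1/2}$ the inverse of $\varSigma^{1/2}$. Minimal lattice: $\mathcal{L}$ is a closed (discrete) subgroup of $\mathbb{R}^d$ of rank $d$ such that $\mathbb{P}(X_1\in x+\mathcal{L})=1$ for every $x\in\mathbb{Z}^d$ with $\mathbb{P}(X_1=x)>0$, and such that whenever $\mathcal{L}'$ is a closed subgroup of $\mathbb{R}^d$ with $\mathbb{P}(X_1\in y+\mathcal{L}')=1$ for some $y\in\mathbb{Z}^d$, one has $\mathcal{L}\subseteq\mathcal{L}'$. $\det(\mathcal{L})$ is the absolute value of the determinant of the matrix whose rows form a $\mathbb{Z}$-basis of $\mathcal{L}$. Urn model: let $R=((p(v-u)))_{u,v\in\mathbb{Z}^d}$ and let $R_u$ be the $u$-th row of $R$. The initial configuration $U_0=(U_{0,v})_{v\in\mathbb{Z}^d}$ is a (non-random) probability vector with $U_{0,v}=0$ for all but finitely many $v\in\mathbb{Z}^d$. For $n\ge0$, the color $Z_n\in\mathbb{Z}^d$ of the $(n+1)$-th selected ball satisfies $\mathbb{P}(Z_n=v\mid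 U_n,\dots,U_0)=U_{n,v}/(n+1)$, $v\in\mathbb{Z}^d$, and $U_{n+1}=U_n+R_{Z_n}$, i.e. $U_{n+1,v}=U_{n,v}+p(v-Z_n)$. (So $\sum_v U_{n,v}=n+1$.) $\phi_d(x)=(2\pi)^{-d/2}e^{-\|x\|^2/2}$ is the standard Gaussian density on $\mathbb{R}^d$.
   Formalization: The initial configuration U_0 is additionally assumed to be supported on the minimal lattice L; otherwise the claim fails, e.g. d=2, X_1 uniform on {0, ±2e_1, ±2e_2}, U_0 a unit mass at e_1, where the supremum tends to 1/(2π). *)

theory Defs
  imports "HOL-Probability.Probability"
begin

section \<open>Vectors and matrices\<close>

text \<open>Vectors are row vectors: a matrix acts on them from the right, by \<^term>\<open>(v*)\<close>.\<close>

definition real_vec :: "int ^ 'd \<Rightarrow> real ^ 'd" where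
  "real_vec u = (\<chi> i. real_of_int (u $ i))"

definition pos_def :: "real ^ 'd ^ 'd \<Rightarrow> bool" where
  "pos_def A \<longleftrightarrow> transpose A = A \<and> (\<forall>x. x \<noteq> 0 \<longrightarrow> (x v* A) \<bullet> x > 0)"

definition pos_def_sqrt :: "real ^ 'd ^ 'd \<Rightarrow> real ^ 'd ^ 'd" where
  "pos_def_sqrt A = (THE S. pos_def S \<and> S ** S = A)"

definition std_gaussian_density :: "real ^ 'd \<Rightarrow> real" where
  "std_gaussian_density x = (2 * pi) powr (- (real CARD('d) / 2)) * exp (- (norm x)\<^sup>2 / 2)"


section \<open>Random vectors with integer coordinates\<close>

definition mass_fun :: "'a measure \<Rightarrow> ('a \<Rightarrow> int ^ 'd) \<Rightarrow> int ^ 'd \<Rightarrow> real" where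
  "mass_fun N Y u = measure N {\<omega> \<in> space N. Y \<omega> = u}"

definition mean_vec :: "'a measure \<Rightarrow> ('a \<Rightarrow> int ^ 'd) \<Rightarrow> real ^ 'd" where
  "mean_vec N Y = (\<integral>\<omega>. real_vec (Y \<omega>) \<partial>N)"

text \<open>
  The expectation of the matrix $Y^T Y$, where the row vector $Y$ is a matrix with a single row;
  it is not centered at the mean.
\<close>

definition second_moment :: "'a measure \<Rightarrow> ('a \<Rightarrow> int ^ 'd) \<Rightarrow> real ^ 'd ^ 'd" where
  "second_moment N Y =
     (\<integral>\<omega>. transpose (rowvector (real_vec (Y \<omega>)) :: real ^ 'd ^ 1) ** rowvector (real_vec (Y \<omega>)) \<partial>N)"

definition iid_sequence :: "'a measure \<Rightarrow> (nat \<Rightarrow> 'a \<Rightarrow> int ^ 'd) \<Rightarrow> bool" where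
  "iid_sequence N X \<longleftrightarrow>
     prob_space N \<and>
     prob_space.indep_vars N (\<lambda>_. count_space UNIV) X {1..} \<and>
     (\<forall>j\<ge>1. distr N (count_space UNIV) (X j) = distr N (count_space UNIV) (X 1))"


section \<open>The minimal lattice\<close>

definition closed_subgroup :: "(real ^ 'd) set \<Rightarrow> bool" where
  "closed_subgroup L \<longleftrightarrow>
     closed L \<and> 0 \<in> L \<and> (\<forall>x\<in>L. \<forall>y\<in>L. x + y \<in> L) \<and> (\<forall>x\<in>L. - x \<in> L)"

text \<open>
  The rows of \<open>B\<close> form a basis of \<open>L\<close> over the integers: every element of \<open>L\<close> is in a unique way
  an integer combination of the rows, and all such combinations lie in \<open>L\<close>.
\<close>

definition int_basis :: "real ^ 'd ^ 'd \<Rightarrow> (real ^ 'd) set \<Rightarrow> bool" where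
  "int_basis B L \<longleftrightarrow> bij_betw (\<lambda>c :: int ^ 'd. real_vec c v* B) UNIV L"

text \<open>The value does not depend on the basis: two bases differ by a unimodular matrix.\<close>

definition lattice_det :: "(real ^ 'd) set \<Rightarrow> real" where
  "lattice_det L = \<bar>det (SOME B. int_basis B L)\<bar>"

definition prob_in_coset :: "'a measure \<Rightarrow> ('a \<Rightarrow> int ^ 'd) \<Rightarrow> real ^ 'd \<Rightarrow> (real ^ 'd) set \<Rightarrow> real" where
  "prob_in_coset N Y x L = measure N {\<omega> \<in> space N. real_vec (Y \<omega>) \<in> (\<lambda>z. x + z) ` L}"

text \<open>Rank \<open>d\<close> is the existence of an integer basis with \<open>d\<close> elements.\<close>

definition minimal_lattice :: "'a measure \<Rightarrow> ('a \<Rightarrow> int ^ 'd) \<Rightarrow> (real ^ 'd) set \<Rightarrow> bool" where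
  "minimal_lattice N Y L \<longleftrightarrow>
     closed_subgroup L \<and> topological_space_class.discrete L \<and> (\<exists>B. int_basis B L) \<and>
     (\<forall>x. mass_fun N Y x > 0 \<longrightarrow> prob_in_coset N Y (real_vec x) L = 1) \<and>
     (\<forall>L'. closed_subgroup L' \<and> (\<exists>y :: int ^ 'd. prob_in_coset N Y (real_vec y) L' = 1)
        \<longrightarrow> L \<subseteq> L')"

text \<open>
  \<open>x0\<close> is the shift, \<open>m\<close> the mean and \<open>S\<close> the inverse square root of the second moment matrix.
\<close>

definition scaled_lattice ::
    "(real ^ 'd) set \<Rightarrow> real ^ 'd \<Rightarrow> real ^ 'd \<Rightarrow> real ^ 'd ^ 'd \<Rightarrow> nat \<Rightarrow> (real ^ 'd) set" where
  "scaled_lattice L x0 m S n =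
     {x. \<exists>z\<in>L. x = (real n / sqrt (ln (real n))) *\<^sub>R (x0 v* S)
                    - sqrt (ln (real n)) *\<^sub>R (m v* S)
                    + (1 / sqrt (ln (real n))) *\<^sub>R (z v* S)}"


section \<open>The urn model\<close>

definition replacement_matrix :: "(int ^ 'd \<Rightarrow> real) \<Rightarrow> int ^ 'd \<Rightarrow> int ^ 'd \<Rightarrow> real" where
  "replacement_matrix p u v = p (v - u)"

definition initial_configuration :: "(int ^ 'd \<Rightarrow> real) \<Rightarrow> bool" where
  "initial_configuration U0 \<longleftrightarrow>
     finite {v. U0 v \<noteq> 0} \<and> (\<forall>v. 0 \<le> U0 v) \<and> (\<Sum>v | U0 v \<noteq> 0. U0 v) = 1"

text \<open>The sigma-algebra generated by the configurations at times \<open>0, \<dots>, n\<close>.\<close>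

definition urn_history :: "'w measure \<Rightarrow> (nat \<Rightarrow> 'w \<Rightarrow> int ^ 'd \<Rightarrow> real) \<Rightarrow> nat \<Rightarrow> 'w measure" where
  "urn_history M U n =
     sigma (space M) {{\<omega> \<in> space M. U k \<omega> v \<in> A} | k v A. k \<le> n \<and> A \<in> sets borel}"

locale urn_model = prob_space M
  for M :: "'w measure" +
  fixes p :: "int ^ 'd \<Rightarrow> real"
    and U0 :: "int ^ 'd \<Rightarrow> real"
    and U :: "nat \<Rightarrow> 'w \<Rightarrow> int ^ 'd \<Rightarrow> real"
    and Z :: "nat \<Rightarrow> 'w \<Rightarrow> int ^ 'd"
  assumes U_measurable: "\<And>n v. (\<lambda>\<omega>. U n \<omega> v) \<in> borel_measurable M"
    and Z_measurable: "\<And>n. Z n \<in> measurable M (count_space UNIV)"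
    and initial: "initial_configuration U0"
    and U_0: "\<And>\<omega> v. \<omega> \<in> space M \<Longrightarrow> U 0 \<omega> v = U0 v"
    and U_Suc: "\<And>n \<omega> v. \<omega> \<in> space M \<Longrightarrow>
                  U (Suc n) \<omega> v = U n \<omega> v + replacement_matrix p (Z n \<omega>) v"
    and selection: "\<And>n v. AE \<omega> in M.
                  real_cond_exp M (urn_history M U n) (indicat_real {\<omega> \<in> space M. Z n \<omega> = v}) \<omega>
                    = U n \<omega> v / (real n + 1)"

end

theory Submission
  imports Defs
begin

text \<open>
  Taking expectations in \<open>U\<^sub>n\<^sub>+\<^sub>1 = U\<^sub>n + R\<^sub>Z\<^sub>n\<close> turns the urn into a linear recursion for the law of \<open>Z\<^sub>n\<close>: in
  terms of characteristic functions every time step multiplies by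
  \<open>1 + (\<phi>(\<theta>) - 1) / (j + 1)\<close>, where \<open>\<phi>\<close> is the characteristic function of \<open>X\<^sub>1\<close>
  (\<open>color_law_finite_support_char_fun\<close>). The product over \<open>j \<le> n\<close> behaves like
  \<open>exp ((\<phi>(\<theta>) - 1) ln n)\<close>, the characteristic function of a random walk stopped at a Poisson time
  with mean \<open>ln n\<close>. This explains the scale \<open>ln n\<close>, and why the limit is governed by the second
  moment matrix \<open>\<Sigma>\<close> and not by the covariance: a Poisson number of steps has covariance
  \<open>\<Sigma> ln n\<close>.

  Because \<open>X\<^sub>1 = 0\<close> has positive probability, all steps and \<open>x0\<close> lie in \<open>L\<close>. So the points of the scaled
  lattice are the images of the points of \<open>L\<close>, and \<open>Z\<^sub>n\<close>, which starts in \<open>L\<close>, never leaves it. Let \<open>Q\<close>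
  be the positive definite square root of \<open>\<Sigma>\<close>. Fourier inversion over a fundamental domain of the dual lattice, followed by the
  substitution \<open>\<theta> = Q\<^sup>-\<^sup>1 s / sqrt (ln n)\<close>, writes the normalized probability at \<open>x\<close> as
  \<open>(2 \<pi>)\<^sup>-\<^sup>d\<close> times the integral of \<open>exp (- i \<langle>s, x\<rangle>) G\<^sub>n(s)\<close>; the normalizing factor
  \<open>det Q (ln n)\<^sup>d\<^sup>/\<^sup>2 / l\<close> is the inverse of its
  Jacobian. The Gaussian density at \<open>x\<close> is the same integral with \<open>G\<^sub>n(s)\<close>
  replaced by \<open>exp (- \<bar>s\<bar>\<^sup>2 / 2)\<close>. So the difference is bounded, uniformly in \<open>x\<close>, by the
  \<open>L\<^sup>1\<close> distance of \<open>G\<^sub>n\<close> and the Gaussian, and dominated convergence finishes the proof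
  (\<open>lattice_local_limit\<close>).

  Pointwise convergence of \<open>G\<^sub>n\<close> is the second order expansion of \<open>\<phi>\<close> at the origin
  (\<open>char_fun_second_order_tendsto\<close>, \<open>urn_product_tendsto\<close>). The dominating function comes from two
  facts: the urn product is at most \<open>C exp (- (1 - Re \<phi>(\<theta>)) ln n)\<close> (\<open>norm_urn_product_le\<close>), and
  \<open>1 - Re \<phi>(\<theta>) \<ge> \<kappa> \<langle>\<Sigma> \<theta>, \<theta>\<rangle>\<close> on the whole fundamental domain (\<open>char_fun_gap\<close>). The second fact is
  where minimality of \<open>L\<close> enters: \<open>Re \<phi>(\<theta>) = 1\<close> makes \<open>\<langle>\<theta>, \<cdot>\<rangle>\<close> a multiple of \<open>2 \<pi>\<close> on the
  steps, hence on \<open>L\<close>, and in the fundamental domain only \<open>\<theta> = 0\<close> has this property.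
\<close>

section \<open>The positive definite square root\<close>

text \<open>
  A maximizer \<open>x\<close> of the Rayleigh quotient on the unit sphere of \<open>V\<close> is an eigenvector: perturbing \<open>x\<close>
  in a direction \<open>v \<in> V\<close> orthogonal to it shows \<open>f x \<bullet> v = 0\<close>, since otherwise the linear term would
  beat the quadratic one for a small perturbation.
\<close>

lemma selfadjoint_eigenvector_in_invariant_subspace:
  fixes f :: "'a::euclidean_space \<Rightarrow> 'a"
  assumes lin: "linear f" and sa: "\<And>x y. f x \<bullet> y = x \<bullet> f y"
    and V: "subspace V" "f ` V \<subseteq> V" "V \<noteq> {0}"
  obtains x c where "x \<in> V" "norm x = 1" "f x = c *\<^sub>R x"
proof -
  let ?K = "sphere 0 1 \<inter> V"
  have K: "compact ?K"
    using closed_subspace[OF V(1)] by (intro compact_Int_closed) auto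
  have K_ne: "?K \<noteq> {}"
  proof -
    obtain v where "v \<in> V" "v \<noteq> 0"
      using V subspace_0 by blast
    then have "(1 / norm v) *\<^sub>R v \<in> ?K"
      using V(1) by (simp add: subspace_scale)
    then show ?thesis by blast
  qed
  have cont: "continuous_on ?K (\<lambda>x. f x \<bullet> x)"
    using lin by (intro continuous_on_inner linear_continuous_on continuous_on_id) (simp add: linear_conv_bounded_linear)
  obtain x where x: "x \<in> ?K" and max: "\<And>y. y \<in> ?K \<Longrightarrow> f y \<bullet> y \<le> f x \<bullet> x"
    using continuous_attains_sup[OF K K_ne cont] by blast
  define c where "c = f x \<bullet> x"
  \<comment> \<open>Homogeneity extends the maximality of \<open>c\<close> from the unit sphere to all of \<open>V\<close>.\<close>
  have quad: "f v \<bullet> v \<le> c * (norm v)\<^sup>2" if "v \<in> V" for v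
  proof (cases "v = 0")
    case False
    then have "(1 / norm v) *\<^sub>R v \<in> ?K"
      using that V(1) by (simp add: subspace_scale)
    from max[OF this] show ?thesis
      using False by (simp add: linear_cmul[OF lin] c_def divide_simps power2_eq_square mult_ac)
  qed (simp add: linear_0[OF lin])
  have xx: "x \<bullet> x = 1" and xV: "x \<in> V"
    using x by (auto simp: norm_eq_1)
  have orth: "f x \<bullet> v = 0" if v: "v \<in> V" "x \<bullet> v = 0" for v
  proof (rule ccontr)
    assume nz: "f x \<bullet> v \<noteq> 0"
    define k where "k = c * (v \<bullet> v) - f v \<bullet> v"
    have *: "2 * t * (f x \<bullet> v) \<le> t\<^sup>2 * k" for t
    proof -
      have "x + t *\<^sub>R v \<in> V"
        using v xV V(1) by (simp add: subspace_add subspace_scale)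
      from quad[OF this] have "f (x + t *\<^sub>R v) \<bullet> (x + t *\<^sub>R v) \<le> c * ((x + t *\<^sub>R v) \<bullet> (x + t *\<^sub>R v))"
        by (simp add: power2_norm_eq_inner)
      moreover have "f v \<bullet> x = f x \<bullet> v"
        using sa[of v x] by (simp add: inner_commute)
      ultimately show ?thesis
        using v xx by (simp add: linear_add[OF lin] linear_cmul[OF lin] inner_add_left inner_add_right
            inner_commute[of v x] c_def[symmetric] power2_eq_square k_def algebra_simps)
    qed
    have "k > 0"
      using *[of 1] *[of "-1"] nz by simp
    then have "2 * (f x \<bullet> v)\<^sup>2 / k \<le> (f x \<bullet> v)\<^sup>2 / k"
      using *[of "(f x \<bullet> v) / k"] by (simp add: power2_eq_square)
    moreover have "(f x \<bullet> v)\<^sup>2 / k > 0"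
      using nz \<open>k > 0\<close> by simp
    ultimately show False by linarith
  qed
  define r where "r = f x - c *\<^sub>R x"
  have "r \<in> V"
    using V xV by (auto simp: r_def subspace_diff subspace_scale)
  moreover have "x \<bullet> r = 0"
    using xx by (simp add: r_def inner_diff_right c_def inner_commute)
  ultimately have "f x \<bullet> r = 0" by (rule orth)
  with \<open>x \<bullet> r = 0\<close> have "r \<bullet> r = 0"
    by (subst (1) r_def) (simp add: inner_diff_left)
  then have "f x = c *\<^sub>R x" by (simp add: r_def)
  with that xV xx show thesis by (simp add: norm_eq_1)
qed

text \<open>
  The spectral theorem, by induction on the dimension: the orthogonal complement of an eigenvector is
  again invariant.
\<close>

lemma selfadjoint_orthonormal_eigenbasis:
  fixes f :: "'a::euclidean_space \<Rightarrow> 'a"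
  assumes lin: "linear f" and sa: "\<And>x y. f x \<bullet> y = x \<bullet> f y"
    and "subspace V" "f ` V \<subseteq> V"
  shows "\<exists>B. finite B \<and> pairwise orthogonal B \<and> span B = V \<and> (\<forall>b\<in>B. norm b = 1 \<and> (\<exists>c. f b = c *\<^sub>R b))"
  using assms(3,4)
proof (induction "dim V" arbitrary: V rule: less_induct)
  case (less V)
  show ?case
  proof (cases "V = {0}")
    case True
    then show ?thesis by (intro exI[of _ "{}"]) auto
  next
    case False
    then obtain x c where x: "x \<in> V" "norm x = 1" "f x = c *\<^sub>R x"
      using selfadjoint_eigenvector_in_invariant_subspace[OF lin sa less.prems(1,2)] by blast
    define W where "W = {v \<in> V. x \<bullet> v = 0}"
    have W: "subspace W"
      using less.prems(1) by (auto simp: W_def subspace_def inner_add_right)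
    have "f ` W \<subseteq> W"
    proof -
      have "x \<bullet> f v = 0" if "x \<bullet> v = 0" for v
        using sa[of x v] that by (simp add: x(3))
      then show ?thesis using less.prems(2) by (auto simp: W_def)
    qed
    have "x \<notin> W" using x by (auto simp: W_def)
    then have "W \<subset> V" using x(1) W_def by blast
    then have "span W \<subset> span V"
      using W less.prems(1) by (metis span_eq_iff)
    then have "dim W < dim V" by (rule dim_psubset)
    from less.hyps[OF this W \<open>f ` W \<subseteq> W\<close>] obtain B where
      B: "finite B" "pairwise orthogonal B" "span B = W" "\<forall>b\<in>B. norm b = 1 \<and> (\<exists>c. f b = c *\<^sub>R b)"
      by blast
    have BW: "b \<in> W" if "b \<in> B" for b using B(3) that span_base by blast
    have "span (insert x B) = V"
    proof
      show "span (insert x B) \<subseteq> V"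
        using x BW less.prems(1) by (intro span_minimal) (auto simp: W_def)
      show "V \<subseteq> span (insert x B)"
      proof
        fix v assume v: "v \<in> V"
        have "v - (x \<bullet> v) *\<^sub>R x \<in> W"
          using v x less.prems(1) by (auto simp: W_def subspace_diff subspace_scale inner_diff_right norm_eq_1)
        then show "v \<in> span (insert x B)"
          by (auto simp: span_insert B(3))
      qed
    qed
    moreover have "pairwise orthogonal (insert x B)"
      using B(2) BW by (auto simp: pairwise_insert W_def orthogonal_def inner_commute)
    ultimately show ?thesis
      using B x by (intro exI[of _ "insert x B"]) auto
  qed
qed

text \<open>
  A positive definite matrix is symmetric, so its two actions, on row and on column vectors, coincide.
\<close>

lemma pos_def_mult_vec:
  assumes "pos_def A"
  shows "x v* A = A *v x" "x \<noteq> 0 \<Longrightarrow> 0 < (A *v x) \<bullet> x" "(A *v x) \<bullet> y = x \<bullet> (A *v y)"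
proof -
  have *: "x v* A = A *v x" for x
    using assms transpose_matrix_vector[of A x] by (simp add: pos_def_def)
  show "x v* A = A *v x" "x \<noteq> 0 \<Longrightarrow> 0 < (A *v x) \<bullet> x" "(A *v x) \<bullet> y = x \<bullet> (A *v y)"
    using assms dot_lmul_matrix[of x A y] by (auto simp: pos_def_def *)
qed

text \<open>
  Existence is the functional calculus in an orthonormal eigenbasis. For uniqueness, a positive definite
  root \<open>R\<close> must agree with it on every eigenvector \<open>b\<close>: with \<open>c\<close> the eigenvalue,
  \<open>(R + sqrt c) (R - sqrt c) b = 0\<close>, and \<open>R + sqrt c\<close> is injective.
\<close>

lemma pos_def_sqrt_unique_exists:
  fixes A :: "real ^ 'd ^ 'd"
  assumes A: "pos_def A"
  shows "\<exists>!S. pos_def S \<and> S ** S = A"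
proof -
  obtain B where B: "finite B" "pairwise orthogonal B" "span B = UNIV"
      "\<And>b. b \<in> B \<Longrightarrow> norm b = 1 \<and> (\<exists>c. A *v b = c *\<^sub>R b)"
    using selfadjoint_orthonormal_eigenbasis[of "(*v) A" UNIV] pos_def_mult_vec[OF A]
    by (auto simp: matrix_vector_mul_linear)
  then obtain c where c: "\<And>b. b \<in> B \<Longrightarrow> A *v b = c b *\<^sub>R b" by metis
  have bb: "b \<bullet> b = 1" if "b \<in> B" for b
    using B(4)[OF that] by (simp add: norm_eq_1)
  have cpos: "c b > 0" if "b \<in> B" for b
    using pos_def_mult_vec(2)[OF A, of b] c[OF that] bb[OF that] by (cases "b = 0") auto
  have expand: "(\<Sum>b\<in>B. (x \<bullet> b) *\<^sub>R b) = x" for x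
    using orthonormal_basis_expand[of B x] B by auto
  have binner: "a \<bullet> b = (if a = b then 1 else 0)" if "a \<in> B" "b \<in> B" for a b
    using that bb B(2) by (auto simp: pairwise_def orthogonal_def)
  define g where "g x = (\<Sum>b\<in>B. (sqrt (c b) * (x \<bullet> b)) *\<^sub>R b)" for x
  have lin: "linear g"
    unfolding g_def by (intro linearI) (simp_all add: inner_add_left algebra_simps sum.distrib scaleR_sum_right)
  have g_basis: "g b = sqrt (c b) *\<^sub>R b" if "b \<in> B" for b
  proof -
    have "g b = (\<Sum>a\<in>B. if a = b then sqrt (c b) *\<^sub>R b else 0)"
      unfolding g_def using that by (intro sum.cong) (auto simp: binner)
    then show ?thesis using that B(1) by simp
  qed
  define S where "S = matrix g"
  have S: "S *v x = g x" for x
    unfolding S_def using matrix_works[of g x] lin by simp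
  have g_inner: "g x \<bullet> y = (\<Sum>b\<in>B. sqrt (c b) * (x \<bullet> b) * (y \<bullet> b))" for x y
    unfolding g_def inner_sum_left by (intro sum.cong) (simp_all add: inner_commute)
  have sym: "g x \<bullet> y = x \<bullet> g y" for x y
    by (simp add: g_inner inner_commute[of x] mult_ac)
  have "transpose S = S"
  proof -
    have "(transpose S *v x) \<bullet> y = (S *v x) \<bullet> y" for x y
      by (simp add: transpose_matrix_vector dot_lmul_matrix S sym)
    then have "transpose S *v x = S *v x" for x
      using vector_eq_rdot by blast
    then show ?thesis by (simp add: matrix_eq)
  qed
  moreover have "(x v* S) \<bullet> x > 0" if "x \<noteq> 0" for x
  proof -
    have nonneg: "0 \<le> sqrt (c b) * (x \<bullet> b) * (x \<bullet> b)" if "b \<in> B" for b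
      using cpos[OF that] by (simp add: mult.assoc)
    have "(\<Sum>b\<in>B. (x \<bullet> b) *\<^sub>R b) \<noteq> 0"
      using expand[of x] that by simp
    then have "\<exists>b\<in>B. (x \<bullet> b) *\<^sub>R b \<noteq> 0"
      by (rule contrapos_np) (simp add: sum.neutral)
    then obtain b where b: "b \<in> B" "x \<bullet> b \<noteq> 0" by auto
    have "0 < sqrt (c b) * (x \<bullet> b) * (x \<bullet> b)"
      using cpos[OF b(1)] b(2) by (auto simp: mult.assoc zero_less_mult_iff)
    then have "0 < (\<Sum>b\<in>B. sqrt (c b) * (x \<bullet> b) * (x \<bullet> b))"
      by (intro sum_pos2[OF B(1) b(1)] nonneg)
    then show ?thesis
      by (simp add: dot_lmul_matrix S inner_commute[of x "g x"] g_inner)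
  qed
  ultimately have "pos_def S" by (simp add: pos_def_def)
  have "(S ** S) *v x = A *v x" for x
  proof (rule linear_eq_on_span[of "(*v) (S ** S)" "(*v) A" B])
    show "(S ** S) *v b = A *v b" if "b \<in> B" for b
      using cpos[OF that]
      by (simp add: matrix_vector_mul_assoc[symmetric] S g_basis linear_cmul[OF lin] that c)
  qed (simp_all add: matrix_vector_mul_linear B)
  then have "S ** S = A" by (simp add: matrix_eq)
  show ?thesis
  proof (intro ex1I conjI; (elim conjE)?)
    show "pos_def S" "S ** S = A" by fact+
    fix R assume R: "pos_def R" "R ** R = A"
    have "R *v x = S *v x" for x
    proof (rule linear_eq_on_span[of "(*v) R" "(*v) S" B])
      fix b assume b: "b \<in> B"
      define w where "w = R *v b - sqrt (c b) *\<^sub>R b"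
      have "R *v (R *v b) = c b *\<^sub>R b"
        using R(2) c[OF b] by (simp add: matrix_vector_mul_assoc)
      \<comment> \<open>Were \<open>w \<noteq> 0\<close>, it would be an eigenvector of \<open>R\<close> with a negative eigenvalue.\<close>
      then have "R *v w = - (sqrt (c b) *\<^sub>R w)"
        using cpos[OF b] by (simp add: w_def algebra_simps matrix_vector_mult_scaleR)
      then have "(R *v w) \<bullet> w \<le> 0"
        using cpos[OF b] by simp
      with pos_def_mult_vec(2)[OF R(1), of w] have "w = 0" by force
      then show "R *v b = S *v b" by (simp add: w_def S g_basis b)
    qed (simp_all add: matrix_vector_mul_linear B)
    then show "R = S" by (simp add: matrix_eq)
  qed
qed

lemma pos_def_sqrt:
  assumes "pos_def A"
  shows "pos_def (pos_def_sqrt A)" "pos_def_sqrt A ** pos_def_sqrt A = A"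
  using theI'[OF pos_def_sqrt_unique_exists[OF assms]] by (auto simp: pos_def_sqrt_def)

lemma pos_def_invertible:
  fixes A :: "real ^ 'd ^ 'd"
  assumes "pos_def A" shows "invertible A"
proof -
  have "x = 0" if "A *v x = 0" for x
    using pos_def_mult_vec(2)[OF assms, of x] that by force
  then show ?thesis
    by (simp add: invertible_left_inverse matrix_left_invertible_ker)
qed

text \<open>
  A positive definite matrix is an invertible square.
\<close>

lemma det_pos_def_pos:
  fixes A :: "real ^ 'd ^ 'd"
  assumes "pos_def A" shows "det A > 0"
proof -
  have "det A = (det (pos_def_sqrt A))\<^sup>2"
    using arg_cong[OF pos_def_sqrt(2)[OF assms], of det] by (simp add: det_mul power2_eq_square)
  moreover have "det A \<noteq> 0"
    using pos_def_invertible[OF assms] by (simp add: invertible_det_nz)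
  ultimately show ?thesis by simp
qed

lemma matrix_inv_inverse:
  assumes "invertible A"
  shows "A ** matrix_inv A = mat 1" "matrix_inv A ** A = mat 1"
  using someI_ex[OF assms[unfolded invertible_def]] by (auto simp: matrix_inv_def)

lemma mat_mult_vec: "mat (c::real) *v x = c *\<^sub>R x"
  by (simp add: vec_eq_iff matrix_vector_mult_def mat_def if_distrib[of "\<lambda>a. a * b" for b] cong: if_cong)

lemma det_mat: "det (mat c :: real ^ 'n ^ 'n) = c ^ CARD('n)"
  by (subst det_diagonal) (simp_all add: mat_def)


section \<open>Linear changes of variables in Lebesgue integrals\<close>

lemma nn_integral_lborel_PiM:
  fixes h :: "'a::euclidean_space \<Rightarrow> ennreal"
  assumes [measurable]: "h \<in> borel_measurable borel"
  shows "(\<integral>\<^sup>+x. h x \<partial>lborel) = (\<integral>\<^sup>+f. h (\<Sum>c\<in>Basis. f c *\<^sub>R c) \<partial>(\<Pi>\<^sub>M c\<in>Basis. lborel))"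
  by (subst lborel_eq, subst nn_integral_distr) simp_all

text \<open>
  By Fubini's theorem, integrate the coordinate along \<open>b\<close> first; with the other coordinates fixed, the
  shear is a translation of that coordinate.
\<close>

lemma nn_integral_lborel_shear:
  fixes g :: "'a::euclidean_space \<Rightarrow> ennreal"
  assumes b: "b \<in> Basis" "b' \<in> Basis" "b \<noteq> b'" and [measurable]: "g \<in> borel_measurable borel"
  shows "(\<integral>\<^sup>+x. g (x + (x \<bullet> b') *\<^sub>R b) \<partial>lborel) = (\<integral>\<^sup>+x. g x \<partial>lborel)"
proof -
  interpret product_sigma_finite "\<lambda>_::'a. lborel :: real measure"
    by unfold_locales
  define R where "R = Basis - {b}"
  have R: "finite R" "b \<notin> R" "insert b R = Basis" "b' \<in> R"
    using b by (auto simp: R_def)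
  \<comment> \<open>\<open>w f y\<close> is the point with coordinate \<open>y\<close> along \<open>b\<close> and its other coordinates given by \<open>f\<close>.\<close>
  define w where "w f y = (\<Sum>c\<in>Basis. (f(b := y)) c *\<^sub>R c)" for f :: "'a \<Rightarrow> real" and y
  have w: "w f y = y *\<^sub>R b + (\<Sum>c\<in>R. f c *\<^sub>R c)" for f y
  proof -
    have "w f y = (f(b := y)) b *\<^sub>R b + (\<Sum>c\<in>R. (f(b := y)) c *\<^sub>R c)"
      unfolding w_def R(3)[symmetric] using R(1,2) by (rule sum.insert)
    also have "(\<Sum>c\<in>R. (f(b := y)) c *\<^sub>R c) = (\<Sum>c\<in>R. f c *\<^sub>R c)"
      using R(2) by (intro sum.cong) auto
    finally show ?thesis by simp
  qed
  have w_b': "w f y \<bullet> b' = f b'" for f y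
  proof -
    have "(f(b := y)) c * (c \<bullet> b') = (if c = b' then f b' else 0)" if "c \<in> Basis" for c
      using b that by (auto simp: inner_Basis)
    then show ?thesis
      using b(2) by (simp add: w_def inner_sum_left del: fun_upd_apply cong: sum.cong)
  qed
  have fubini: "(\<integral>\<^sup>+x. h x \<partial>lborel) = (\<integral>\<^sup>+f. (\<integral>\<^sup>+y. h (w f y) \<partial>lborel) \<partial>(\<Pi>\<^sub>M c\<in>R. lborel))"
    if [measurable]: "h \<in> borel_measurable borel" for h :: "'a \<Rightarrow> ennreal"
    unfolding nn_integral_lborel_PiM[OF that] w_def R(3)[symmetric]
    by (rule product_nn_integral_insert[OF R(1,2)]) (simp add: R(3))
  have "(\<integral>\<^sup>+x. g (x + (x \<bullet> b') *\<^sub>R b) \<partial>lborel) =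
      (\<integral>\<^sup>+f. (\<integral>\<^sup>+y. g (w f y + (w f y \<bullet> b') *\<^sub>R b) \<partial>lborel) \<partial>(\<Pi>\<^sub>M c\<in>R. lborel))"
    by (rule fubini) simp
  also have "\<dots> = (\<integral>\<^sup>+f. (\<integral>\<^sup>+y. g (w f (f b' + 1 * y)) \<partial>lborel) \<partial>(\<Pi>\<^sub>M c\<in>R. lborel))"
    unfolding w_b' by (simp add: w algebra_simps)
  also have "\<dots> = (\<integral>\<^sup>+f. (\<integral>\<^sup>+y. g (w f y) \<partial>lborel) \<partial>(\<Pi>\<^sub>M c\<in>R. lborel))"
  proof (rule nn_integral_cong)
    fix f
    have "(\<lambda>y. g (w f y)) \<in> borel_measurable borel"
      unfolding w by measurable
    from nn_integral_real_affine[OF this, of 1 "f b'"]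
    show "(\<integral>\<^sup>+y. g (w f (f b' + 1 * y)) \<partial>lborel) = (\<integral>\<^sup>+y. g (w f y) \<partial>lborel)"
      by simp
  qed
  also have "\<dots> = (\<integral>\<^sup>+x. g x \<partial>lborel)"
    by (rule fubini[symmetric]) simp
  finally show ?thesis .
qed

lemma Basis_cart_eq: "(Basis :: (real^'n) set) = range (\<lambda>i. axis i 1)"
  by (auto simp: Basis_vec_def)

lemma sum_Basis_cart: "(\<Sum>b\<in>Basis. f b) = (\<Sum>i\<in>UNIV. f (axis i 1 :: real^'n))"
  unfolding Basis_cart_eq by (subst sum.reindex) (auto simp: inj_on_def axis_eq_axis)

lemma prod_Basis_cart: "(\<Prod>b\<in>Basis. f b) = (\<Prod>i\<in>UNIV. f (axis i 1 :: real^'n))"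
  unfolding Basis_cart_eq by (subst prod.reindex) (auto simp: inj_on_def axis_eq_axis)

lemma lborel_distr_swap:
  fixes m n :: "'n::finite"
  defines "h \<equiv> \<lambda>x::real^'n. \<chi> i. x $ Transposition.transpose m n i"
  shows "distr lborel borel h = (lborel :: (real^'n) measure)"
proof (rule lborel_eqI[symmetric])
  let ?t = "Transposition.transpose m n"
  have [measurable]: "h \<in> borel_measurable borel"
    unfolding h_def by (intro borel_measurable_continuous_onI continuous_on_vec_lambda continuous_intros)
  fix l u :: "real^'n"
  assume le: "\<And>b. b \<in> Basis \<Longrightarrow> l \<bullet> b \<le> u \<bullet> b"
  then have le': "l $ i \<le> u $ i" for i
    using le[of "axis i 1"] by (auto simp: Basis_cart_eq inner_axis)
  have prod_eq: "(\<Prod>b\<in>Basis. (v - w) \<bullet> b) = (\<Prod>i\<in>UNIV. v $ i - w $ i)" for v w :: "real^'n"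
    by (simp add: prod_Basis_cart inner_axis)
  have "h -` box l u = box (h l) (h u)"
    unfolding h_def by (auto simp: mem_box_cart) (metis transpose_involutory)+
  then have "emeasure (distr lborel borel h) (box l u) = emeasure lborel (box (h l) (h u))"
    by (simp add: emeasure_distr)
  also have "\<dots> = (\<Prod>b\<in>Basis. (h u - h l) \<bullet> b)"
    using le' by (intro emeasure_lborel_box) (auto simp: h_def Basis_vec_def inner_axis)
  also have "(\<Prod>b\<in>Basis. (h u - h l) \<bullet> b) = (\<Prod>b\<in>Basis. (u - l) \<bullet> b)"
    using prod.permute[OF permutes_swap_id, of m UNIV n "\<lambda>i. u $ i - l $ i"]
    by (simp add: prod_eq h_def o_def)
  finally show "emeasure (distr lborel borel h) (box l u) = ennreal (\<Prod>b\<in>Basis. (u - l) \<bullet> b)" .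
qed simp

lemma borel_measurable_linear:
  fixes T :: "real^'n \<Rightarrow> real^'n"
  assumes "linear T" shows "T \<in> borel_measurable borel"
  using assms
  by (intro borel_measurable_continuous_onI linear_continuous_on) (simp add: linear_conv_bounded_linear)

text \<open>
  Linear maps are generated by diagonal maps, transpositions of coordinates and shears, and the formula
  is multiplicative in \<open>T\<close>.
\<close>

lemma nn_integral_lborel_linear:
  fixes T :: "real^'n \<Rightarrow> real^'n"
  assumes "linear T" "det (matrix T) \<noteq> 0" "g \<in> borel_measurable borel"
  shows "ennreal \<bar>det (matrix T)\<bar> * (\<integral>\<^sup>+x. g (T x) \<partial>lborel) = (\<integral>\<^sup>+x. g x \<partial>lborel)"
proof -
  let ?P = "\<lambda>T :: real^'n \<Rightarrow> real^'n. det (matrix T) \<noteq> 0 \<longrightarrow> (\<forall>g\<in>borel_measurable borel.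
      ennreal \<bar>det (matrix T)\<bar> * (\<integral>\<^sup>+x. g (T x) \<partial>lborel) = (\<integral>\<^sup>+x. g x \<partial>lborel))"
  have "?P T"
  proof (rule induct_linear_elementary[OF assms(1)])
    fix f h :: "real^'n \<Rightarrow> real^'n"
    assume lin: "linear f" "linear h" and P: "?P f" "?P h"
    show "?P (f \<circ> h)"
    proof (intro impI ballI)
      fix g :: "real^'n \<Rightarrow> ennreal"
      assume nz: "det (matrix (f \<circ> h)) \<noteq> 0" and g [measurable]: "g \<in> borel_measurable borel"
      have det: "det (matrix (f \<circ> h)) = det (matrix f) * det (matrix h)"
        using lin by (simp add: matrix_compose det_mul)
      have [measurable]: "f \<in> borel_measurable borel" by (rule borel_measurable_linear[OF lin(1)])
      have f: "ennreal \<bar>det (matrix f)\<bar> * (\<integral>\<^sup>+x. g (f x) \<partial>lborel) = (\<integral>\<^sup>+x. g x \<partial>lborel)"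
        using P(1) nz det g by simp
      have h: "ennreal \<bar>det (matrix h)\<bar> * (\<integral>\<^sup>+x. g (f (h x)) \<partial>lborel) = (\<integral>\<^sup>+x. g (f x) \<partial>lborel)"
        using P(2) nz det by (auto dest!: bspec[where x="\<lambda>x. g (f x)"])
      show "ennreal \<bar>det (matrix (f \<circ> h))\<bar> * (\<integral>\<^sup>+x. g ((f \<circ> h) x) \<partial>lborel) = (\<integral>\<^sup>+x. g x \<partial>lborel)"
        unfolding f[symmetric] h[symmetric] by (simp add: det abs_mult ennreal_mult mult.assoc)
    qed
  next
    fix f :: "real^'n \<Rightarrow> real^'n" and i
    assume "linear f" and 0: "\<And>x. f x $ i = 0"
    then have "\<not> inj f"
      by (metis (full_types) linear_injective_imp_surjective one_neq_zero surjE vec_component)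
    then show "?P f"
      using det_nz_iff_inj[OF \<open>linear f\<close>] by blast
  next
    fix c :: "'n \<Rightarrow> real"
    let ?h = "\<lambda>x::real^'n. \<chi> i. c i * x $ i"
    have det: "det (matrix ?h) = (\<Prod>i\<in>UNIV. c i)"
      by (simp add: axis_def matrix_def det_diagonal)
    show "?P ?h"
    proof (intro impI ballI)
      fix g :: "real^'n \<Rightarrow> ennreal"
      assume nz: "det (matrix ?h) \<noteq> 0" and g [measurable]: "g \<in> borel_measurable borel"
      have c: "c i \<noteq> 0" for i
        using nz by (simp add: det)
      have h: "?h = (\<lambda>x. 0 + (\<Sum>b\<in>Basis. ((vec_lambda c \<bullet> b) * (x \<bullet> b)) *\<^sub>R b))"
        by (simp add: fun_eq_iff vec_eq_iff sum_Basis_cart inner_axis)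
          (simp add: axis_def if_distrib cong: if_cong)
      have "(lborel :: (real^'n) measure) =
          density (distr lborel borel ?h) (\<lambda>_. \<Prod>b\<in>Basis. \<bar>vec_lambda c \<bullet> b\<bar>)"
        unfolding h using c by (intro lborel_affine_euclidean) (auto simp: Basis_cart_eq inner_axis)
      also have "(\<Prod>b\<in>Basis. \<bar>vec_lambda c \<bullet> b\<bar>) = \<bar>det (matrix ?h)\<bar>"
        by (simp add: det prod_Basis_cart inner_axis abs_prod)
      finally have L: "(lborel :: (real^'n) measure) =
          density (distr lborel borel ?h) (\<lambda>_. \<bar>det (matrix ?h)\<bar>)" .
      have [measurable]: "?h \<in> borel_measurable borel"
        by (rule borel_measurable_linear) (auto intro!: linearI simp: vec_eq_iff algebra_simps)
      show "ennreal \<bar>det (matrix ?h)\<bar> * (\<integral>\<^sup>+x. g (?h x) \<partial>lborel) = (\<integral>\<^sup>+x. g x \<partial>lborel)"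
        by (subst (2) L) (simp add: nn_integral_density nn_integral_distr nn_integral_cmult)
    qed
  next
    fix m n :: 'n
    assume "m \<noteq> n"
    let ?t = "Transposition.transpose m n"
    let ?h = "\<lambda>x::real^'n. \<chi> i. x $ ?t i"
    have lin: "linear ?h"
      by (rule linearI) (simp_all add: plus_vec_def scaleR_vec_def)
    have "(\<chi> i j. if ?t i = j then 1 else 0) = (\<chi> i j. if j = ?t i then 1 else (0::real))"
      by (auto intro!: Cart_lambda_cong)
    then have "matrix ?h = Finite_Cartesian_Product.transpose (\<chi> i j. mat 1 $ i $ ?t j)"
      by (auto simp: matrix_eq Finite_Cartesian_Product.transpose_def axis_def mat_def matrix_def)
    then have det: "\<bar>det (matrix ?h)\<bar> = 1"
      by (simp add: det_permute_columns permutes_swap_id sign_swap_id abs_mult)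
    show "?P ?h"
    proof (intro impI ballI)
      fix g :: "real^'n \<Rightarrow> ennreal"
      assume g [measurable]: "g \<in> borel_measurable borel"
      have [measurable]: "?h \<in> borel_measurable borel" by (rule borel_measurable_linear[OF lin])
      show "ennreal \<bar>det (matrix ?h)\<bar> * (\<integral>\<^sup>+x. g (?h x) \<partial>lborel) = (\<integral>\<^sup>+x. g x \<partial>lborel)"
        by (subst (2) lborel_distr_swap[of m n, symmetric]) (simp add: nn_integral_distr det)
    qed
  next
    fix m n :: 'n
    assume mn: "m \<noteq> n"
    let ?h = "\<lambda>x::real^'n. \<chi> i. if i = m then x $ m + x $ n else x $ i"
    have "matrix ?h = (\<chi> k. if k = m then row m (mat 1) + 1 *s row n (mat 1) else row k (mat 1))"
      by (auto simp: vec_eq_iff matrix_def axis_def row_def mat_def)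
    then have det: "det (matrix ?h) = 1"
      using det_row_operation[OF mn, of "mat 1 :: real^'n^'n" 1] by simp
    have h: "?h x = x + (x \<bullet> axis n 1) *\<^sub>R axis m 1" for x
      using mn by (simp add: vec_eq_iff inner_axis) (simp add: axis_def)
    show "?P ?h"
    proof (intro impI ballI)
      fix g :: "real^'n \<Rightarrow> ennreal"
      assume "g \<in> borel_measurable borel"
      then have "(\<integral>\<^sup>+x. g (x + (x \<bullet> axis n 1) *\<^sub>R axis m 1) \<partial>lborel) = (\<integral>\<^sup>+x. g x \<partial>lborel)"
        using mn by (intro nn_integral_lborel_shear) (auto simp: Basis_cart_eq axis_eq_axis)
      then show "ennreal \<bar>det (matrix ?h)\<bar> * (\<integral>\<^sup>+x. g (?h x) \<partial>lborel) = (\<integral>\<^sup>+x. g x \<partial>lborel)"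
        unfolding det unfolding h by simp
    qed
  qed
  then show ?thesis using assms by blast
qed

lemma integral_lborel_linear:
  fixes T :: "real^'n \<Rightarrow> real^'n" and G :: "real^'n \<Rightarrow> 'b::{banach,second_countable_topology}"
  assumes T: "linear T" "det (matrix T) \<noteq> 0" and G [measurable]: "G \<in> borel_measurable borel"
  shows "(\<integral>x. G x \<partial>lborel) = \<bar>det (matrix T)\<bar> *\<^sub>R (\<integral>x. G (T x) \<partial>lborel)"
proof -
  have [measurable]: "T \<in> borel_measurable borel"
    by (rule borel_measurable_linear[OF T(1)])
  have L: "(lborel :: (real^'n) measure) = density (distr lborel borel T) (\<lambda>_. \<bar>det (matrix T)\<bar>)"
  proof (rule measure_eqI)
    fix A :: "(real^'n) set"
    assume "A \<in> sets lborel"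
    then have [measurable]: "A \<in> sets borel" by simp
    have "emeasure (distr lborel borel T) A = (\<integral>\<^sup>+x. indicator A (T x) \<partial>lborel)"
      using nn_integral_distr[of T lborel borel "indicator A"] by simp
    then have "emeasure (density (distr lborel borel T) (\<lambda>_. \<bar>det (matrix T)\<bar>)) A =
        ennreal \<bar>det (matrix T)\<bar> * (\<integral>\<^sup>+x. indicator A (T x) \<partial>lborel)"
      by (simp add: emeasure_density nn_integral_cmult)
    also have "\<dots> = emeasure lborel A"
      by (subst nn_integral_lborel_linear[OF T]) simp_all
    finally show "emeasure lborel A = emeasure (density (distr lborel borel T) (\<lambda>_. \<bar>det (matrix T)\<bar>)) A" ..
  qed simp
  show ?thesis
    by (subst L) (simp add: integral_density integral_distr)
qed


section \<open>Fourier integrals over the cube and of the Gaussian\<close>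

lemma
  fixes f :: "'a::euclidean_space \<Rightarrow> real \<Rightarrow> 'b::{real_normed_field,banach,second_countable_topology}"
  assumes "\<And>b. b \<in> Basis \<Longrightarrow> integrable lborel (f b)"
  shows integrable_lborel_prod_Basis: "integrable lborel (\<lambda>x. \<Prod>b\<in>Basis. f b (x \<bullet> b))"
    and integral_lborel_prod_Basis:
      "(\<integral>x. (\<Prod>b\<in>Basis. f b (x \<bullet> b)) \<partial>lborel) = (\<Prod>b\<in>Basis. \<integral>x. f b x \<partial>lborel)"
proof -
  interpret product_sigma_finite "\<lambda>_::'a. lborel :: real measure"
    by unfold_locales
  have [measurable]: "f b \<in> borel_measurable borel" if "b \<in> Basis" for b
    using borel_measurable_integrable[OF assms[OF that]] by simp
  have meas: "(\<lambda>x::'a. \<Prod>b\<in>Basis. f b (x \<bullet> b)) \<in> borel_measurable borel"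
    by measurable
  have eq: "(\<Prod>b\<in>Basis. f b ((\<Sum>c\<in>Basis. g c *\<^sub>R c) \<bullet> b)) = (\<Prod>b\<in>Basis. f b (g b))" for g
    by (intro prod.cong) (simp_all add: inner_sum_left_Basis)
  show "integrable lborel (\<lambda>x. \<Prod>b\<in>Basis. f b (x \<bullet> b))"
    using product_integrable_prod[OF finite_Basis assms] meas
    by (subst lborel_eq, subst integrable_distr_eq) (simp_all add: eq)
  show "(\<integral>x. (\<Prod>b\<in>Basis. f b (x \<bullet> b)) \<partial>lborel) = (\<Prod>b\<in>Basis. \<integral>x. f b x \<partial>lborel)"
    using product_integral_prod[OF finite_Basis assms] meas
    by (subst lborel_eq, subst integral_distr) (simp_all add: eq)
qed

lemma iexp_inner_Basis: "iexp (t \<bullet> c) = (\<Prod>b\<in>Basis. iexp ((t \<bullet> b) * (c \<bullet> b)))"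
  by (subst euclidean_inner) (simp add: sum_distrib_left exp_sum)

text \<open>
  Orthogonality of the characters in one variable; the product over the coordinates gives
  \<open>integral_iexp_period_cube\<close>.
\<close>

lemma integral_iexp_period:
  assumes "k \<in> \<int>"
  shows "(\<integral>x. indicator {-pi..pi} x *\<^sub>R iexp (x * k) \<partial>lborel) = (if k = 0 then 2 * pi else 0)"
proof (cases "k = 0")
  case True
  then show ?thesis by (simp add: scaleR_conv_of_real)
next
  case False
  have "(\<integral>x. indicator {-pi..pi} x *\<^sub>R iexp (x * k) \<partial>lborel)
      = iexp (pi * k) / (\<i> * k) - iexp (- pi * k) / (\<i> * k)"
  proof (rule integral_FTC_atLeastAtMost)
    show "((\<lambda>x. iexp (x * k) / (\<i> * k)) has_vector_derivative iexp (x * k)) (at x within {-pi..pi})" for x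
    proof -
      have "((\<lambda>z. exp (\<i> * (z * k)) / (\<i> * k)) has_field_derivative exp (\<i> * (of_real x * k))) (at (of_real x))"
        using False by (auto intro!: derivative_eq_intros simp: mult_ac)
      from has_vector_derivative_real_field[OF this] show ?thesis by simp
    qed
    show "continuous_on {-pi..pi} (\<lambda>x. iexp (x * k))"
      by (intro continuous_intros)
  qed simp
  also have "iexp (pi * k) = iexp (- pi * k)"
  proof -
    have "iexp (pi * k) = iexp (- pi * k) * iexp (2 * pi * k)"
      by (simp add: exp_add[symmetric] algebra_simps)
    also have "iexp (2 * pi * k) = 1"
      using assms by (auto simp: exp_eq_1 elim!: Ints_cases)
    finally show ?thesis by simp
  qed
  finally show ?thesis using False by simp
qed

definition period_cube :: "'a::euclidean_space set" where
  "period_cube = {t. \<forall>b\<in>Basis. \<bar>t \<bullet> b\<bar> \<le> pi}"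

lemma period_cube_eq_cbox: "(period_cube :: 'a::euclidean_space set) = cbox (- (pi *\<^sub>R One)) (pi *\<^sub>R One)"
  by (auto simp: period_cube_def mem_box abs_le_iff) (metis minus_le_iff)+

lemma period_cube_measurable [measurable]: "period_cube \<in> sets borel"
  by (simp add: period_cube_eq_cbox)

lemma indicator_period_cube:
  "indicat_real period_cube t = (\<Prod>b\<in>Basis. indicat_real {-pi..pi} (t \<bullet> b))"
  by (auto simp: period_cube_def indicator_def abs_le_iff minus_le_iff)

lemma
  fixes c :: "'a::euclidean_space"
  assumes "\<And>b. b \<in> Basis \<Longrightarrow> c \<bullet> b \<in> \<int>"
  shows integral_iexp_period_cube: "(\<integral>t. indicator period_cube t *\<^sub>R iexp (t \<bullet> c) \<partial>lborel)
      = (if c = 0 then (2 * pi) ^ DIM('a) else 0)"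
    and integrable_iexp_period_cube: "integrable lborel (\<lambda>t. indicator period_cube t *\<^sub>R iexp (t \<bullet> c))"
proof -
  define f where "f b x = indicator {-pi..pi} x *\<^sub>R iexp (x * (c \<bullet> b))" for b x
  have int: "integrable lborel (f b)" for b
    unfolding f_def
    by (intro borel_integrable_atLeastAtMost'[unfolded set_integrable_def] continuous_intros)
  have eq: "indicator period_cube t *\<^sub>R iexp (t \<bullet> c) = (\<Prod>b\<in>Basis. f b (t \<bullet> b))" for t
    by (subst iexp_inner_Basis)
       (simp add: indicator_period_cube f_def scaleR_conv_of_real prod.distrib)
  show "integrable lborel (\<lambda>t. indicator period_cube t *\<^sub>R iexp (t \<bullet> c))"
    unfolding eq by (rule integrable_lborel_prod_Basis[OF int])
  have f_int: "(\<integral>x. f b x \<partial>lborel) = (if c \<bullet> b = 0 then 2 * pi else 0)" if "b \<in> Basis" for b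
    unfolding f_def by (rule integral_iexp_period[OF assms[OF that]])
  have "(\<integral>t. indicator period_cube t *\<^sub>R iexp (t \<bullet> c) \<partial>lborel) = (\<Prod>b\<in>Basis. if c \<bullet> b = 0 then 2 * pi else 0)"
    unfolding eq integral_lborel_prod_Basis[OF int] by (simp add: f_int)
  also have "\<dots> = (if c = 0 then (2 * pi) ^ DIM('a) else 0)"
  proof (cases "c = 0")
    case False
    then obtain b where "b \<in> Basis" "c \<bullet> b \<noteq> 0"
      by (metis euclidean_all_zero_iff)
    then show ?thesis using False by (auto intro!: prod_zero)
  qed simp
  finally show "(\<integral>t. indicator period_cube t *\<^sub>R iexp (t \<bullet> c) \<partial>lborel)
      = (if c = 0 then (2 * pi) ^ DIM('a) else 0)" by simp
qed

lemma exp_norm_square_Basis: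
  "exp (c * (norm x)\<^sup>2) = (\<Prod>b\<in>Basis. exp (c * (x \<bullet> b)\<^sup>2))" for c :: real
proof -
  have "(norm x)\<^sup>2 = (\<Sum>b\<in>Basis. (x \<bullet> b)\<^sup>2)"
    by (subst power2_norm_eq_inner, subst euclidean_inner) (simp add: power2_eq_square)
  then show ?thesis by (simp add: exp_sum[symmetric] sum_distrib_left)
qed

lemma integrable_exp_neg_norm_square:
  assumes "c > 0"
  shows "integrable lborel (\<lambda>x::'a::euclidean_space. exp (- c * (norm x)\<^sup>2))"
proof -
  define s where "s = 1 / sqrt (2 * c)"
  have s: "s > 0" "s\<^sup>2 = 1 / (2 * c)"
    using assms by (auto simp: s_def power_divide)
  have "exp (- c * x\<^sup>2) = sqrt (2 * pi * s\<^sup>2) * normal_density 0 s x" for x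
    using s(1) assms by (simp add: normal_density_def) (simp add: s(2) mult.commute)
  then have "integrable lborel (\<lambda>x::real. exp (- c * x\<^sup>2))"
    using s(1) by simp
  from integrable_lborel_prod_Basis[OF this]
  show ?thesis by (simp only: exp_norm_square_Basis)
qed

text \<open>
  The Gaussian density as an inverse Fourier transform of a Gaussian; both sides factor over the
  coordinates, and one factor is the characteristic function of the standard normal distribution.
\<close>

lemma gaussian_fourier_integral:
  "(\<integral>s. iexp (- (s \<bullet> x)) * exp (- (norm s)\<^sup>2 / 2) \<partial>lborel)
    = (2 * pi) ^ CARD('d) * std_gaussian_density (x :: real^'d)"
proof -
  define f where "f b s = iexp (s * - (x \<bullet> b)) * exp (- s\<^sup>2 / 2)" for b :: "real^'d" and s :: real
  have f: "f b s = sqrt (2 * pi) * (std_normal_density s *\<^sub>R iexp (- (x \<bullet> b) * s))" for b s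
    by (simp add: f_def std_normal_density_def scaleR_conv_of_real mult_ac)
  have int: "integrable lborel (\<lambda>s. std_normal_density s *\<^sub>R iexp (- (x \<bullet> b) * s))" for b
  proof (rule Bochner_Integration.integrable_bound)
    show "integrable lborel std_normal_density" by simp
  qed (auto)
  have "(\<integral>s. std_normal_density s *\<^sub>R iexp (- (x \<bullet> b) * s) \<partial>lborel) = exp (- (x \<bullet> b)\<^sup>2 / 2)" for b
    using fun_cong[OF char_std_normal_distribution, of "- (x \<bullet> b)"]
    unfolding char_def by (subst (asm) integral_density) (auto)
  moreover have "(\<integral>s. f b s \<partial>lborel) = complex_of_real (sqrt (2 * pi)) *
      (\<integral>s. std_normal_density s *\<^sub>R iexp (- (x \<bullet> b) * s) \<partial>lborel)" for b
    unfolding f by (rule integral_mult_right_zero)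
  ultimately have f_int: "(\<integral>s. f b s \<partial>lborel) = sqrt (2 * pi) * exp (- (x \<bullet> b)\<^sup>2 / 2)" for b
    by simp
  have f_intble: "integrable lborel (f b)" for b
    unfolding f using int by (intro integrable_mult_right) auto
  have "(\<integral>s. iexp (- (s \<bullet> x)) * exp (- (norm s)\<^sup>2 / 2) \<partial>lborel) = (\<integral>s. (\<Prod>b\<in>Basis. f b (s \<bullet> b)) \<partial>lborel)"
  proof (intro Bochner_Integration.integral_cong refl)
    fix s :: "real^'d"
    have "iexp (- (s \<bullet> x)) = (\<Prod>b\<in>Basis. iexp ((s \<bullet> b) * - (x \<bullet> b)))"
      using iexp_inner_Basis[of s "- x"] by simp
    moreover have "exp (- (norm s)\<^sup>2 / 2) = (\<Prod>b\<in>Basis. exp (- (s \<bullet> b)\<^sup>2 / 2))"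
      using exp_norm_square_Basis[of "- 1 / 2" s] by simp
    ultimately show "iexp (- (s \<bullet> x)) * exp (- (norm s)\<^sup>2 / 2) = (\<Prod>b\<in>Basis. f b (s \<bullet> b))"
      by (simp add: f_def prod.distrib)
  qed
  also have "\<dots> = (\<Prod>b\<in>Basis. sqrt (2 * pi) * exp (- (x \<bullet> b)\<^sup>2 / 2))"
    by (simp add: integral_lborel_prod_Basis[OF f_intble] f_int)
  also have "(\<Prod>b\<in>Basis. sqrt (2 * pi) * exp (- (x \<bullet> b)\<^sup>2 / 2)) = sqrt (2 * pi) ^ CARD('d) * exp (- (norm x)\<^sup>2 / 2)"
    using exp_norm_square_Basis[of "- 1 / 2" x] by (simp add: prod.distrib)
  also have "sqrt (2 * pi) ^ CARD('d) = (2 * pi) powr (real CARD('d) / 2)"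
    by (simp add: powr_half_sqrt[symmetric] powr_realpow[symmetric] powr_powr)
  also have "\<dots> = (2 * pi) ^ CARD('d) * (2 * pi) powr (- (real CARD('d) / 2))"
  proof -
    have "a powr (real CARD('d) / 2) = a ^ CARD('d) * a powr (- (real CARD('d) / 2))" if "a > 0" for a :: real
      using that by (simp add: powr_realpow[symmetric] powr_add[symmetric])
    then show ?thesis by simp
  qed
  finally show ?thesis by (simp add: std_gaussian_density_def mult_ac)
qed


section \<open>The product of the urn factors\<close>

text \<open>
  With \<open>z\<close> the characteristic function of a step, this is the factor that leads from the characteristic
  function of \<open>Z\<^sub>0\<close> to that of \<open>Z\<^sub>n\<close>.
\<close>

definition urn_product :: "nat \<Rightarrow> complex \<Rightarrow> complex" where
  "urn_product n z = (\<Prod>j=1..n. 1 + (z - 1) / of_nat (j + 1))"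

lemma sum_inverse_Suc_near_ln:
  "\<exists>C. \<forall>n\<ge>1. \<bar>(\<Sum>j=1..n. 1 / real (j + 1)) - ln (real n)\<bar> \<le> C"
proof -
  have eq: "(\<Sum>j=1..n. 1 / real (j + 1)) = harm n + 1 / real (n + 1) - 1" for n
    by (induction n) (simp_all add: harm_Suc harm_expand inverse_eq_divide)
  have "convergent (\<lambda>n. harm n - ln (real n))"
    using euler_mascheroni_LIMSEQ by (auto simp: convergent_def)
  from convergent_imp_Bseq[OF this] obtain K where K: "\<forall>n. norm (harm n - ln (real n)) \<le> K"
    by (elim BseqE)
  show ?thesis
  proof (intro exI allI impI)
    fix n :: nat assume "n \<ge> 1"
    moreover have "0 \<le> 1 / real (n + 1)" "1 / real (n + 1) \<le> 1" by auto
    ultimately show "\<bar>(\<Sum>j=1..n. 1 / real (j + 1)) - ln (real n)\<bar> \<le> K + 1"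
      using spec[OF K, of n] unfolding eq real_norm_def by linarith
  qed
qed

lemma sum_inverse_Suc_square_le: "(\<Sum>j=1..n. 1 / (real (j + 1))\<^sup>2) \<le> 1"
proof -
  have "(\<Sum>j=1..n. 1 / (real (j + 1))\<^sup>2) \<le> 1 - 1 / real (n + 1)"
  proof (induction n)
    case (Suc n)
    \<comment> \<open>The bound telescopes.\<close>
    have "1 / (real (Suc n + 1))\<^sup>2 \<le> 1 / real (n + 1) - 1 / real (Suc n + 1)"
    proof -
      have "1 / (real (Suc n + 1))\<^sup>2 \<le> 1 / (real (n + 1) * real (Suc n + 1))"
        unfolding power2_eq_square by (intro divide_left_mono mult_right_mono) auto
      also have "\<dots> = 1 / real (n + 1) - 1 / real (Suc n + 1)"
        by (simp add: field_simps)
      finally show ?thesis .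
    qed
    with Suc show ?case by simp
  qed simp
  also have "\<dots> \<le> 1" by simp
  finally show ?thesis .
qed

text \<open>
  Clearing denominators, \<open>\<bar>j + z\<bar>\<^sup>2 \<le> (j + 1)\<^sup>2 - 2 j (1 - Re z)\<close> because \<open>\<bar>z\<bar> \<le> 1\<close>. The exponent
  differs from \<open>- (1 - Re z) / (j + 1)\<close> by a summable amount, so nothing is lost in the product.
\<close>

lemma norm_urn_factor_le:
  fixes z :: complex
  assumes z: "cmod z \<le> 1"
  shows "cmod (1 + (z - 1) / of_nat (j + 1)) \<le> exp (- (1 - Re z) * (real j / (real (j + 1))\<^sup>2))"
proof (rule power2_le_imp_le)
  define k where "k = real (j + 1)"
  have k: "k > 0" and j: "real j = k - 1" and k_of_nat: "(of_nat (j + 1) :: complex) = of_real k"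
    by (auto simp: k_def)
  have "(cmod z)\<^sup>2 \<le> 1"
    using z by (intro power_le_one) auto
  then have "(Re z)\<^sup>2 + (Im z)\<^sup>2 \<le> 1"
    by (simp add: cmod_power2)
  moreover have "(k - 1 + Re z)\<^sup>2 + (Im z)\<^sup>2 = (k - 1)\<^sup>2 + 2 * (k - 1) * Re z + ((Re z)\<^sup>2 + (Im z)\<^sup>2)"
    "(k - 1)\<^sup>2 + 2 * (k - 1) * Re z + 1 = k\<^sup>2 - 2 * (k - 1) * (1 - Re z)"
    by (simp_all add: power2_eq_square algebra_simps)
  ultimately have le: "(k - 1 + Re z)\<^sup>2 + (Im z)\<^sup>2 \<le> k\<^sup>2 - 2 * (k - 1) * (1 - Re z)"
    by linarith
  have "1 + (z - 1) / of_real k = (of_real (k - 1) + z) / of_real k"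
    using k by (simp add: field_simps)
  then have "(cmod (1 + (z - 1) / of_nat (j + 1)))\<^sup>2 = ((k - 1 + Re z)\<^sup>2 + (Im z)\<^sup>2) / k\<^sup>2"
    by (simp only: k_of_nat norm_divide power_divide cmod_power2) simp
  also have "\<dots> \<le> (k\<^sup>2 - 2 * (k - 1) * (1 - Re z)) / k\<^sup>2"
    using le by (rule divide_right_mono) simp
  also have "\<dots> = 1 + 2 * (- (1 - Re z) * ((k - 1) / k\<^sup>2))"
    using k by (simp add: field_simps)
  also have "\<dots> = 1 + 2 * (- (1 - Re z) * (real j / (real (j + 1))\<^sup>2))"
    unfolding j[symmetric] unfolding k_def ..
  also have "\<dots> \<le> exp (2 * (- (1 - Re z) * (real j / (real (j + 1))\<^sup>2)))"
    by (rule exp_ge_add_one_self)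
  also have "\<dots> = (exp (- (1 - Re z) * (real j / (real (j + 1))\<^sup>2)))\<^sup>2"
    by (rule exp_double)
  finally show "(cmod (1 + (z - 1) / of_nat (j + 1)))\<^sup>2 \<le> (exp (- (1 - Re z) * (real j / (real (j + 1))\<^sup>2)))\<^sup>2" .
qed simp

text \<open>
  The constant is uniform in \<open>z\<close> on the unit disc, so that it can serve at every frequency.
\<close>

lemma norm_urn_product_le:
  obtains C where "C > 0"
    "\<And>n z. n \<ge> 1 \<Longrightarrow> cmod z \<le> 1 \<Longrightarrow> cmod (urn_product n z) \<le> C * exp (- (1 - Re z) * ln (real n))"
proof -
  obtain K where K: "\<And>n. n \<ge> 1 \<Longrightarrow> \<bar>(\<Sum>j=1..n. 1 / real (j + 1)) - ln (real n)\<bar> \<le> K"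
    using sum_inverse_Suc_near_ln by blast
  have "cmod (urn_product n z) \<le> exp (2 * (K + 1)) * exp (- (1 - Re z) * ln (real n))"
    if n: "n \<ge> 1" and z: "cmod z \<le> 1" for n z
  proof -
    let ?a = "1 - Re z"
    have a: "0 \<le> ?a" "?a \<le> 2"
      using abs_Re_le_cmod[of z] z by linarith+
    have "cmod (urn_product n z) \<le> (\<Prod>j=1..n. exp (- ?a * (real j / (real (j + 1))\<^sup>2)))"
      unfolding urn_product_def prod_norm[symmetric]
      by (intro prod_mono conjI norm_ge_zero norm_urn_factor_le z)
    also have "\<dots> = exp (- ?a * (\<Sum>j=1..n. real j / (real (j + 1))\<^sup>2))"
      by (simp only: exp_sum[symmetric] finite_atLeastAtMost sum_distrib_left)
    also have "(\<Sum>j=1..n. real j / (real (j + 1))\<^sup>2) =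
        (\<Sum>j=1..n. 1 / real (j + 1)) - (\<Sum>j=1..n. 1 / (real (j + 1))\<^sup>2)"
      unfolding sum_subtractf[symmetric]
      by (intro sum.cong refl) (simp add: divide_simps power2_eq_square)
    also have "exp (- ?a * \<dots>) \<le> exp (2 * (K + 1) - ?a * ln (real n))"
    proof -
      let ?d = "ln (real n) - ((\<Sum>j=1..n. 1 / real (j + 1)) - (\<Sum>j=1..n. 1 / (real (j + 1))\<^sup>2))"
      have "?d \<le> K + 1"
        using K[OF n] sum_inverse_Suc_square_le[of n] by linarith
      moreover have "0 \<le> K + 1"
        using K[of 1] by linarith
      ultimately have "?a * ?d \<le> 2 * (K + 1)"
        using a by (meson mult_left_mono mult_right_mono order_trans)
      then show ?thesis by (simp add: algebra_simps)
    qed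
    also have "\<dots> = exp (2 * (K + 1)) * exp (- ?a * ln (real n))"
      by (simp only: exp_add[symmetric] mult_minus_left diff_conv_add_uminus)
    finally show ?thesis .
  qed
  then show thesis by (intro that[of "exp (2 * (K + 1))"]) auto
qed

lemma norm_exp_minus_linear_le:
  fixes a :: complex
  assumes "cmod a \<le> 1"
  shows "cmod (1 + a - exp a) \<le> 3 * (cmod a)\<^sup>2"
proof -
  have "cmod (exp a - (\<Sum>k\<le>1. a ^ k / fact k)) \<le> exp \<bar>Re a\<bar> * cmod a ^ Suc 1 / fact 1"
    by (rule Taylor_exp)
  moreover have "exp \<bar>Re a\<bar> \<le> 3"
  proof -
    have "exp \<bar>Re a\<bar> \<le> exp 1"
      using abs_Re_le_cmod[of a] assms by simp
    then show ?thesis using exp_le by linarith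
  qed
  then have "exp \<bar>Re a\<bar> * (cmod a)\<^sup>2 \<le> 3 * (cmod a)\<^sup>2"
    by (intro mult_right_mono) auto
  moreover have "(\<Sum>k\<le>1. a ^ k / fact k) = 1 + a"
    by (simp add: atMost_Suc)
  ultimately have "cmod (exp a - (1 + a)) \<le> 3 * (cmod a)\<^sup>2"
    by (simp add: power2_eq_square)
  then show ?thesis by (simp add: norm_minus_commute)
qed

text \<open>
  Both products have factors in the unit disc, so their distance is at most the sum of the distances of
  the factors, each of which is a second order remainder.
\<close>

lemma urn_product_minus_exp_le:
  assumes "cmod z \<le> 1"
  shows "cmod (urn_product n z - exp ((z - 1) * of_real (\<Sum>j=1..n. 1 / real (j + 1)))) \<le> 3 * (cmod (z - 1))\<^sup>2"
proof -
  let ?a = "\<lambda>j. (z - 1) / of_nat (j + 1)"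
  have "Re z \<le> 1"
    using abs_Re_le_cmod[of z] assms by linarith
  have le1: "cmod (1 + ?a j) \<le> 1" for j
  proof -
    have "- (1 - Re z) * (real j / (real (j + 1))\<^sup>2) \<le> 0"
      using \<open>Re z \<le> 1\<close> by (intro mult_nonpos_nonneg) auto
    then show ?thesis
      using norm_urn_factor_le[OF assms, of j] by (meson exp_le_one_iff order_trans)
  qed
  have exp_le1: "cmod (exp (?a j)) \<le> 1" for j
  proof -
    have "?a j = (z - 1) / of_real (real (j + 1))" by simp
    then have "Re (?a j) = (Re z - 1) / real (j + 1)"
      by (simp only: Re_divide_of_real) simp
    then show ?thesis
      using \<open>Re z \<le> 1\<close> by (simp add: divide_nonpos_nonneg)
  qed
  have a1: "cmod (?a j) \<le> 1" if "j \<ge> 1" for j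
  proof -
    have "cmod (z - 1) \<le> 2"
      using norm_triangle_ineq4[of z 1] assms by simp
    also have "\<dots> \<le> real (j + 1)" using that by simp
    finally show ?thesis by (simp only: norm_divide norm_of_nat divide_le_eq_1) auto
  qed
  have "exp ((z - 1) * of_real (\<Sum>j=1..n. 1 / real (j + 1))) = (\<Prod>j=1..n. exp (?a j))"
    by (simp add: exp_sum[symmetric] sum_distrib_left)
  then have "cmod (urn_product n z - exp ((z - 1) * of_real (\<Sum>j=1..n. 1 / real (j + 1))))
      \<le> (\<Sum>j=1..n. cmod (1 + ?a j - exp (?a j)))"
    unfolding urn_product_def by (simp only:) (intro norm_prod_diff le1 exp_le1)
  also have "\<dots> \<le> (\<Sum>j=1..n. 3 * (cmod (?a j))\<^sup>2)"
    by (intro sum_mono norm_exp_minus_linear_le a1) simp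
  also have "\<dots> = 3 * (cmod (z - 1))\<^sup>2 * (\<Sum>j=1..n. 1 / (real (j + 1))\<^sup>2)"
    by (simp only: norm_divide norm_of_nat power_divide sum_distrib_left) simp
  also have "\<dots> \<le> 3 * (cmod (z - 1))\<^sup>2 * 1"
    by (intro mult_left_mono sum_inverse_Suc_square_le) simp
  finally show ?thesis by simp
qed

text \<open>
  The sequence \<open>\<theta>\<close> allows for an oscillation of the product that does not converge: in the application
  it is the drift \<open>\<mu> ln n\<close> of the color, seen at a frequency of order \<open>1 / sqrt (ln n)\<close>.
\<close>

lemma urn_product_tendsto:
  fixes z :: "nat \<Rightarrow> complex" and \<theta> :: "nat \<Rightarrow> real"
  assumes le: "\<And>n. cmod (z n) \<le> 1" and lim: "z \<longlonglongrightarrow> 1"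
    and log: "(\<lambda>n. (z n - 1) * of_real (ln (real n)) - \<i> * of_real (\<theta> n)) \<longlonglongrightarrow> q"
  shows "(\<lambda>n. urn_product n (z n) * iexp (- \<theta> n)) \<longlonglongrightarrow> exp q"
proof -
  define H where "H n = (\<Sum>j=1..n. 1 / real (j + 1))" for n :: nat
  obtain K where K: "\<And>n. n \<ge> 1 \<Longrightarrow> \<bar>H n - ln (real n)\<bar> \<le> K"
    unfolding H_def using sum_inverse_Suc_near_ln by blast
  have z0: "(\<lambda>n. z n - 1) \<longlonglongrightarrow> 0"
    using lim by (simp add: LIM_zero_iff)
  have "(\<lambda>n. (z n - 1) * of_real (H n - ln (real n))) \<longlonglongrightarrow> 0"
  proof (rule Lim_null_comparison)
    show "\<forall>\<^sub>F n in sequentially. norm ((z n - 1) * of_real (H n - ln (real n))) \<le> norm (z n - 1) * K"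
      using eventually_ge_at_top[of 1]
      by eventually_elim (auto simp: norm_mult intro!: mult_left_mono K simp flip: of_real_diff)
    show "(\<lambda>n. norm (z n - 1) * K) \<longlonglongrightarrow> 0"
      using tendsto_mult_left_zero[OF tendsto_norm_zero[OF z0]] .
  qed
  from tendsto_add[OF log this]
  have "(\<lambda>n. (z n - 1) * of_real (H n) - \<i> * of_real (\<theta> n)) \<longlonglongrightarrow> q"
    by (simp add: algebra_simps)
  then have e: "(\<lambda>n. exp ((z n - 1) * of_real (H n) - \<i> * of_real (\<theta> n))) \<longlonglongrightarrow> exp q"
    by (rule tendsto_exp)
  have "(\<lambda>n. (urn_product n (z n) - exp ((z n - 1) * of_real (H n))) * iexp (- \<theta> n)) \<longlonglongrightarrow> 0"
  proof (rule Lim_null_comparison)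
    show "\<forall>\<^sub>F n in sequentially. norm ((urn_product n (z n) - exp ((z n - 1) * of_real (H n))) * iexp (- \<theta> n))
        \<le> 3 * (cmod (z n - 1))\<^sup>2"
      using urn_product_minus_exp_le[OF le]
      by (intro always_eventually allI) (simp add: norm_mult H_def)
    have "(\<lambda>n. 3 * (cmod (z n - 1))\<^sup>2) \<longlonglongrightarrow> 3 * (cmod 0)\<^sup>2"
      by (intro tendsto_intros z0)
    then show "(\<lambda>n. 3 * (cmod (z n - 1))\<^sup>2) \<longlonglongrightarrow> 0" by simp
  qed
  moreover have "exp ((z n - 1) * of_real (H n) - \<i> * of_real (\<theta> n)) =
      exp ((z n - 1) * of_real (H n)) * iexp (- \<theta> n)" for n
    by (simp add: exp_add[symmetric])
  ultimately show ?thesis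
    using tendsto_add[OF _ e] by (fastforce simp: left_diff_distrib)
qed


section \<open>The law of the selected color\<close>

lemma real_vec_add: "real_vec (u + v) = real_vec u + real_vec v"
  and real_vec_zero: "real_vec 0 = 0"
  and real_vec_eq_iff: "real_vec u = real_vec v \<longleftrightarrow> u = v"
  by (simp_all add: real_vec_def vec_eq_iff)

text \<open>
  The characteristic function of a law with finite support; over an infinite support the sum is \<open>0\<close> by
  convention.
\<close>

definition char_fun :: "(int ^ 'd \<Rightarrow> real) \<Rightarrow> real ^ 'd \<Rightarrow> complex" where
  "char_fun q \<theta> = (\<Sum>v | q v \<noteq> 0. of_real (q v) * iexp (\<theta> \<bullet> real_vec v))"

lemma char_fun_eq_sum:
  assumes "finite S" "\<And>v. q v \<noteq> 0 \<Longrightarrow> v \<in> S"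
  shows "char_fun q \<theta> = (\<Sum>v\<in>S. of_real (q v) * iexp (\<theta> \<bullet> real_vec v))"
  unfolding char_fun_def using assms by (intro sum.mono_neutral_left) auto

lemma norm_char_fun_le:
  assumes "\<And>v. q v \<ge> 0" "(\<Sum>v | q v \<noteq> 0. q v) = 1"
  shows "cmod (char_fun q \<theta>) \<le> 1"
proof -
  have "cmod (char_fun q \<theta>) \<le> (\<Sum>v | q v \<noteq> 0. cmod (of_real (q v) * iexp (\<theta> \<bullet> real_vec v)))"
    unfolding char_fun_def by (rule norm_sum)
  also have "\<dots> = (\<Sum>v | q v \<noteq> 0. q v)"
    using assms(1) by (simp add: norm_mult)
  finally show ?thesis using assms(2) by simp
qed

lemma continuous_on_char_fun [continuous_intros]:
  "continuous_on S f \<Longrightarrow> continuous_on S (\<lambda>x. char_fun q (f x))"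
  unfolding char_fun_def by (intro continuous_intros)

lemma char_fun_convolution:
  fixes p q :: "int ^ 'd \<Rightarrow> real"
  assumes B: "finite B" "\<And>u. p u \<noteq> 0 \<Longrightarrow> u \<in> B" and q: "finite {v. q v \<noteq> 0}"
  shows "finite {v. (\<Sum>u\<in>B. p u * q (v - u)) \<noteq> 0}"
    and "char_fun (\<lambda>v. \<Sum>u\<in>B. p u * q (v - u)) \<theta> = char_fun p \<theta> * char_fun q \<theta>"
proof -
  let ?S = "{v. q v \<noteq> 0}"
  define T where "T = (\<lambda>(u, w). u + w) ` (B \<times> ?S)"
  have T: "finite T" using B(1) q by (simp add: T_def)
  have sub: "v \<in> T" if nz: "(\<Sum>u\<in>B. p u * q (v - u)) \<noteq> 0" for v
  proof -
    obtain u where "u \<in> B" "p u * q (v - u) \<noteq> 0"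
      using nz by (rule sum.not_neutral_contains_not_neutral)
    then show ?thesis unfolding T_def by (intro image_eqI[of _ _ "(u, v - u)"]) auto
  qed
  then have "{v. (\<Sum>u\<in>B. p u * q (v - u)) \<noteq> 0} \<subseteq> T" by blast
  with T show "finite {v. (\<Sum>u\<in>B. p u * q (v - u)) \<noteq> 0}" by (rule rev_finite_subset)
  have shift: "(\<Sum>v\<in>T. of_real (q (v - u)) * iexp (\<theta> \<bullet> real_vec v)) = iexp (\<theta> \<bullet> real_vec u) * char_fun q \<theta>"
    if u: "u \<in> B" for u
  proof -
    have "(\<Sum>v\<in>T. of_real (q (v - u)) * iexp (\<theta> \<bullet> real_vec v)) =
        (\<Sum>v\<in>(\<lambda>w. u + w) ` ?S. of_real (q (v - u)) * iexp (\<theta> \<bullet> real_vec v))"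
    proof (intro sum.mono_neutral_right T ballI)
      show "(\<lambda>w. u + w) ` ?S \<subseteq> T" using u by (auto simp: T_def)
      fix v assume v: "v \<in> T - (\<lambda>w. u + w) ` ?S"
      have "q (v - u) = 0"
      proof (rule ccontr)
        assume "q (v - u) \<noteq> 0"
        then have "v \<in> (\<lambda>w. u + w) ` ?S" by (intro image_eqI[of _ _ "v - u"]) auto
        with v show False by simp
      qed
      then show "of_real (q (v - u)) * iexp (\<theta> \<bullet> real_vec v) = 0" by simp
    qed
    also have "\<dots> = (\<Sum>w\<in>?S. of_real (q w) * iexp (\<theta> \<bullet> real_vec (u + w)))"
      by (subst sum.reindex) (auto simp: inj_on_def)
    also have "\<dots> = iexp (\<theta> \<bullet> real_vec u) * char_fun q \<theta>"
      by (simp add: char_fun_def sum_distrib_left real_vec_add inner_add_right exp_add algebra_simps)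
    finally show ?thesis .
  qed
  have "char_fun (\<lambda>v. \<Sum>u\<in>B. p u * q (v - u)) \<theta> =
      (\<Sum>v\<in>T. of_real (\<Sum>u\<in>B. p u * q (v - u)) * iexp (\<theta> \<bullet> real_vec v))"
    using sub by (intro char_fun_eq_sum T) blast
  also have "\<dots> = (\<Sum>u\<in>B. of_real (p u) * (\<Sum>v\<in>T. of_real (q (v - u)) * iexp (\<theta> \<bullet> real_vec v)))"
    by (simp add: sum_distrib_left sum_distrib_right mult.assoc) (rule sum.swap)
  also have "\<dots> = (\<Sum>u\<in>B. of_real (p u) * iexp (\<theta> \<bullet> real_vec u)) * char_fun q \<theta>"
    by (simp add: shift sum_distrib_right mult.assoc)
  also have "(\<Sum>u\<in>B. of_real (p u) * iexp (\<theta> \<bullet> real_vec u)) = char_fun p \<theta>"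
    using B by (intro char_fun_eq_sum[symmetric])
  finally show "char_fun (\<lambda>v. \<Sum>u\<in>B. p u * q (v - u)) \<theta> = char_fun p \<theta> * char_fun q \<theta>" .
qed

context urn_model
begin

definition color_law :: "nat \<Rightarrow> int ^ 'd \<Rightarrow> real" where
  "color_law n v = prob {\<omega> \<in> space M. Z n \<omega> = v}"

lemma color_event [measurable]: "{\<omega> \<in> space M. Z n \<omega> = v} \<in> events"
  using measurable_sets[OF Z_measurable[of n], of "{v}"]
  by (simp add: vimage_def Int_def conj_commute)

lemma integrable_color_indicator: "integrable M (indicat_real {\<omega> \<in> space M. Z n \<omega> = v})"
  by (intro integrable_real_indicator color_event) (simp add: less_top[symmetric])

lemma urn_history_subalgebra: "subalgebra M (urn_history M U n)"
proof -
  let ?G = "{{\<omega> \<in> space M. U k \<omega> v \<in> A} | k v A. k \<le> n \<and> A \<in> sets borel}"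
  have "?G \<subseteq> events"
  proof clarify
    fix k v and A :: "real set"
    assume "A \<in> sets borel"
    from measurable_sets[OF U_measurable[of k v] this]
    show "{\<omega> \<in> space M. U k \<omega> v \<in> A} \<in> events"
      by (simp add: vimage_def Int_def conj_commute)
  qed
  moreover have "?G \<subseteq> Pow (space M)" by blast
  ultimately show ?thesis
    unfolding subalgebra_def urn_history_def
    by (simp add: space_measure_of sets_measure_of sets.sigma_sets_subset)
qed

text \<open>
  The conditional law of \<open>Z\<^sub>n\<close> given the history is \<open>U\<^sub>n / (n + 1)\<close>; take expectations.
\<close>

lemma color_law_eq_expected_configuration:
  "color_law n v = expectation (\<lambda>\<omega>. U n \<omega> v) / (real n + 1)"
proof -
  interpret finite_measure_subalgebra M "urn_history M U n"
    by unfold_locales (rule urn_history_subalgebra)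
  have "color_law n v = expectation (indicat_real {\<omega> \<in> space M. Z n \<omega> = v})"
    by (simp add: color_law_def)
  also have "\<dots> = expectation (real_cond_exp M (urn_history M U n) (indicat_real {\<omega> \<in> space M. Z n \<omega> = v}))"
    by (rule real_cond_exp_int(2)[OF integrable_color_indicator, symmetric])
  also have "\<dots> = expectation (\<lambda>\<omega>. U n \<omega> v / (real n + 1))"
    by (rule integral_cong_AE) (use U_measurable in \<open>auto intro: selection\<close>)
  finally show ?thesis by simp
qed

lemma color_law_0: "color_law 0 v = U0 v"
proof -
  have "expectation (\<lambda>\<omega>. U 0 \<omega> v) = expectation (\<lambda>_. U0 v)"
    by (intro Bochner_Integration.integral_cong) (auto simp: U_0)
  then show ?thesis by (simp add: color_law_eq_expected_configuration prob_space)
qed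

text \<open>
  Only expectations of the configuration enter, so the reinforcement becomes a linear recursion: with
  weight \<open>1 / (n + 2)\<close> the next color is the previous one moved by an independent step.
\<close>

lemma color_law_Suc:
  assumes B: "finite B" "\<And>u. p u \<noteq> 0 \<Longrightarrow> u \<in> B"
  shows "color_law (Suc n) v =
    ((real n + 1) * color_law n v + (\<Sum>u\<in>B. p u * color_law n (v - u))) / (real n + 2)"
proof -
  let ?ind = "\<lambda>n u. indicat_real {\<omega> \<in> space M. Z n \<omega> = v - u}"
  have step: "U (Suc n) \<omega> v = U n \<omega> v + (\<Sum>u\<in>B. p u * ?ind n u \<omega>)" if "\<omega> \<in> space M" for n \<omega>
  proof -
    have "(\<Sum>u\<in>B. p u * ?ind n u \<omega>) = (\<Sum>u\<in>B. if u = v - Z n \<omega> then p u else 0)"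
      using that by (intro sum.cong) (auto simp: indicator_def)
    also have "\<dots> = p (v - Z n \<omega>)"
      using B by auto
    finally show ?thesis using U_Suc[OF that] by (simp add: replacement_matrix_def)
  qed
  have int: "integrable M (\<lambda>\<omega>. U n \<omega> v)" for n
  proof (induction n)
    case 0
    have "integrable M (\<lambda>\<omega>. U 0 \<omega> v) \<longleftrightarrow> integrable M (\<lambda>_. U0 v)"
      by (intro Bochner_Integration.integrable_cong) (auto simp: U_0)
    then show ?case by simp
  next
    case (Suc n)
    have "integrable M (\<lambda>\<omega>. U (Suc n) \<omega> v) \<longleftrightarrow> integrable M (\<lambda>\<omega>. U n \<omega> v + (\<Sum>u\<in>B. p u * ?ind n u \<omega>))"
      by (intro Bochner_Integration.integrable_cong) (auto simp: step)
    also have "\<dots>"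
      by (intro Bochner_Integration.integrable_add Suc Bochner_Integration.integrable_sum
          integrable_mult_right integrable_color_indicator)
    finally show ?case .
  qed
  have "expectation (\<lambda>\<omega>. U (Suc n) \<omega> v) = expectation (\<lambda>\<omega>. U n \<omega> v + (\<Sum>u\<in>B. p u * ?ind n u \<omega>))"
    by (intro Bochner_Integration.integral_cong) (auto simp: step)
  also have "\<dots> = expectation (\<lambda>\<omega>. U n \<omega> v) + (\<Sum>u\<in>B. p u * color_law n (v - u))"
  proof -
    have "expectation (\<lambda>\<omega>. \<Sum>u\<in>B. p u * ?ind n u \<omega>) = (\<Sum>u\<in>B. expectation (\<lambda>\<omega>. p u * ?ind n u \<omega>))"
      by (intro Bochner_Integration.integral_sum integrable_mult_right integrable_color_indicator)
    also have "\<dots> = (\<Sum>u\<in>B. p u * color_law n (v - u))"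
      by (simp add: color_law_def)
    finally show ?thesis
      by (subst Bochner_Integration.integral_add[OF int])
        (auto intro!: Bochner_Integration.integrable_sum integrable_mult_right integrable_color_indicator)
  qed
  finally have "expectation (\<lambda>\<omega>. U (Suc n) \<omega> v) =
      expectation (\<lambda>\<omega>. U n \<omega> v) + (\<Sum>u\<in>B. p u * color_law n (v - u))" .
  moreover have "(real n + 1) * color_law n v = expectation (\<lambda>\<omega>. U n \<omega> v)"
    by (simp add: color_law_eq_expected_configuration)
  moreover have "color_law (Suc n) v = expectation (\<lambda>\<omega>. U (Suc n) \<omega> v) / (real n + 2)"
    by (simp add: color_law_eq_expected_configuration add.commute)
  ultimately show ?thesis by simp
qed

lemma color_law_support:
  assumes B: "finite B" "\<And>u. p u \<noteq> 0 \<Longrightarrow> u \<in> B"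
    and G: "\<And>v. U0 v \<noteq> 0 \<Longrightarrow> v \<in> G" "\<And>u. p u \<noteq> 0 \<Longrightarrow> u \<in> G" "\<And>u v. u \<in> G \<Longrightarrow> v \<in> G \<Longrightarrow> u + v \<in> G"
  shows "color_law n v \<noteq> 0 \<Longrightarrow> v \<in> G"
proof (induction n arbitrary: v)
  case 0
  then show ?case by (simp add: color_law_0 G(1))
next
  case (Suc n)
  then have "color_law n v \<noteq> 0 \<or> (\<Sum>u\<in>B. p u * color_law n (v - u)) \<noteq> 0"
    by (auto simp: color_law_Suc[OF B])
  then show ?case
  proof
    assume "(\<Sum>u\<in>B. p u * color_law n (v - u)) \<noteq> 0"
    then obtain u where "p u * color_law n (v - u) \<noteq> 0"
      by (rule sum.not_neutral_contains_not_neutral)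
    then have "p u \<noteq> 0" "color_law n (v - u) \<noteq> 0" by auto
    then have "u + (v - u) \<in> G" using Suc.IH G by blast
    then show ?thesis by simp
  qed (rule Suc.IH)
qed

lemma color_law_finite_support_char_fun:
  assumes B: "finite B" "\<And>u. p u \<noteq> 0 \<Longrightarrow> u \<in> B"
  shows "finite {v. color_law n v \<noteq> 0} \<and>
    char_fun (color_law n) \<theta> = char_fun U0 \<theta> * urn_product n (char_fun p \<theta>)"
proof (induction n)
  case 0
  then show ?case
    using initial by (simp add: color_law_0 urn_product_def initial_configuration_def char_fun_def)
next
  case (Suc n)
  let ?q = "color_law n" and ?r = "\<lambda>v. \<Sum>u\<in>B. p u * color_law n (v - u)"
  have fin: "finite {v. ?q v \<noteq> 0}" "finite {v. ?r v \<noteq> 0}"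
    using Suc char_fun_convolution(1)[OF B] by auto
  define S where "S = {v. ?q v \<noteq> 0} \<union> {v. ?r v \<noteq> 0}"
  have S: "finite S" "\<And>v. ?q v \<noteq> 0 \<Longrightarrow> v \<in> S" "\<And>v. ?r v \<noteq> 0 \<Longrightarrow> v \<in> S"
    using fin by (auto simp: S_def)
  have sub: "v \<in> S" if "color_law (Suc n) v \<noteq> 0" for v
  proof (rule ccontr)
    assume "v \<notin> S"
    then have "?q v = 0" "?r v = 0" using S(2,3) by blast+
    with that show False by (simp add: color_law_Suc[OF B])
  qed
  then have "{v. color_law (Suc n) v \<noteq> 0} \<subseteq> S" by blast
  then have "finite {v. color_law (Suc n) v \<noteq> 0}"
    using S(1) finite_subset by blast
  moreover have "char_fun (color_law (Suc n)) \<theta> =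
      (\<Sum>v\<in>S. of_real (color_law (Suc n) v) * iexp (\<theta> \<bullet> real_vec v))"
    by (rule char_fun_eq_sum[OF S(1) sub])
  moreover have "\<dots> = ((of_nat n + 1) * (\<Sum>v\<in>S. of_real (?q v) * iexp (\<theta> \<bullet> real_vec v))
      + (\<Sum>v\<in>S. of_real (?r v) * iexp (\<theta> \<bullet> real_vec v))) / (of_nat n + 2)"
    by (simp add: color_law_Suc[OF B] sum_distrib_left sum.distrib[symmetric] sum_divide_distrib
        algebra_simps del: of_real_sum)
  moreover have "(\<Sum>v\<in>S. of_real (?q v) * iexp (\<theta> \<bullet> real_vec v)) = char_fun ?q \<theta>"
    by (rule char_fun_eq_sum[OF S(1,2), symmetric])
  moreover have "(\<Sum>v\<in>S. of_real (?r v) * iexp (\<theta> \<bullet> real_vec v)) = char_fun p \<theta> * char_fun ?q \<theta>"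
  proof -
    have "(\<Sum>v\<in>S. of_real (?r v) * iexp (\<theta> \<bullet> real_vec v)) = char_fun ?r \<theta>"
      by (rule char_fun_eq_sum[symmetric]) (use S in blast)+
    also have "\<dots> = char_fun p \<theta> * char_fun ?q \<theta>"
      by (rule char_fun_convolution(2)[OF B fin(1)])
    finally show ?thesis .
  qed
  moreover have "((of_nat n + 1) * char_fun ?q \<theta> + char_fun p \<theta> * char_fun ?q \<theta>) / (of_nat n + 2) =
      char_fun ?q \<theta> * (1 + (char_fun p \<theta> - 1) / of_nat (Suc n + 1))"
  proof -
    have "(of_nat n + 2 :: complex) \<noteq> 0"
      by (metis of_nat_add of_nat_numeral of_nat_eq_0_iff add_eq_0_iff_both_eq_0 zero_neq_numeral)
    then show ?thesis by (simp add: field_simps)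
  qed
  ultimately show ?case
    using Suc by (simp add: urn_product_def)
qed

end

text \<open>
  In coordinates with respect to the basis \<open>D\<close>, the lattice is the integer lattice and orthogonality of
  the characters on the cube recovers \<open>q w\<close>. The frequency is already written as \<open>A s\<close> for the
  substitution that makes the limiting Gaussian standard.
\<close>

lemma lattice_fourier_inversion:
  fixes A D :: "real ^ 'd ^ 'd"
  assumes D: "int_basis D L" and det: "det (D ** A) \<noteq> 0"
    and q: "finite {v. q v \<noteq> 0}" "\<And>v. q v \<noteq> 0 \<Longrightarrow> real_vec v \<in> L" and w: "real_vec w \<in> L"
  shows "of_real ((2 * pi) ^ CARD('d) * q w) = of_real \<bar>det (D ** A)\<bar> *
    (\<integral>s. indicator period_cube ((D ** A) *v s) *\<^sub>R
      (iexp (- ((A *v s) \<bullet> real_vec w)) * char_fun q (A *v s)) \<partial>lborel)"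
proof -
  define S where "S = {v. q v \<noteq> 0}"
  have "\<forall>v. \<exists>c. real_vec v \<in> L \<longrightarrow> real_vec v = real_vec c v* D"
    using D by (auto simp: int_basis_def bij_betw_def)
  then obtain c where c: "\<And>v. real_vec v \<in> L \<Longrightarrow> real_vec v = real_vec (c v) v* D"
    by metis
  have inner: "(A *v s) \<bullet> real_vec v = ((D ** A) *v s) \<bullet> real_vec (c v)" if "real_vec v \<in> L" for s v
  proof -
    have "(A *v s) \<bullet> real_vec v = (A *v s) \<bullet> (real_vec (c v) v* D)"
      using c[OF that] by simp
    also have "\<dots> = real_vec (c v) \<bullet> (D *v (A *v s))"
      by (simp add: inner_commute[of "A *v s"] dot_lmul_matrix)
    finally show ?thesis
      by (simp add: matrix_vector_mul_assoc inner_commute)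
  qed
  have c_eq: "real_vec (c v) = real_vec (c w) \<longleftrightarrow> v = w" if "real_vec v \<in> L" for v
    using c[OF that] c[OF w] by (auto simp: real_vec_eq_iff) (metis real_vec_eq_iff)
  \<comment> \<open>In the dual coordinates \<open>t\<close> only the term \<open>v = w\<close> has a nonzero integral over the cube.\<close>
  define G where "G t = (\<Sum>v\<in>S. of_real (q v) * (indicator period_cube t *\<^sub>R
      iexp (t \<bullet> (real_vec (c v) - real_vec (c w)))))" for t :: "real ^ 'd"
  have ints: "(real_vec (c v) - real_vec (c w)) \<bullet> b \<in> \<int>" if "b \<in> Basis" for v and b :: "real ^ 'd"
    using that by (auto simp: Basis_cart_eq inner_axis real_vec_def)
  have "(\<integral>t. G t \<partial>lborel) = (\<Sum>v\<in>S. of_real (q v) *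
      (if real_vec (c v) - real_vec (c w) = 0 then of_real ((2 * pi) ^ CARD('d)) else 0))"
    unfolding G_def
    by (subst Bochner_Integration.integral_sum)
      (auto intro!: integrable_mult_right integrable_iexp_period_cube ints sum.cong
        simp: integral_mult_right_zero integral_iexp_period_cube[OF ints] simp del: mult_scaleR_right)
  also have "\<dots> = (\<Sum>v\<in>S. if v = w then of_real ((2 * pi) ^ CARD('d) * q w) else 0)"
    using q(2) by (intro sum.cong) (auto simp: c_eq S_def)
  also have "\<dots> = of_real ((2 * pi) ^ CARD('d) * q w)"
    using q(1) by (auto simp: S_def)
  finally have "of_real ((2 * pi) ^ CARD('d) * q w) = (\<integral>t. G t \<partial>lborel)" ..
  also have "G \<in> borel_measurable borel"
    unfolding G_def
    by (intro borel_measurable_sum borel_measurable_times borel_measurable_scaleR borel_measurable_indicator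
        borel_measurable_const period_cube_measurable borel_measurable_continuous_onI continuous_intros)
  then have "(\<integral>t. G t \<partial>lborel) = \<bar>det (D ** A)\<bar> *\<^sub>R (\<integral>s. G ((D ** A) *v s) \<partial>lborel)"
    using integral_lborel_linear[of "(*v) (D ** A)" G] det
    by (simp add: matrix_vector_mul_linear)
  also have "(\<lambda>s. G ((D ** A) *v s)) = (\<lambda>s. indicator period_cube ((D ** A) *v s) *\<^sub>R
      (iexp (- ((A *v s) \<bullet> real_vec w)) * char_fun q (A *v s)))"
  proof
    fix s
    have "((D ** A) *v s) \<bullet> (real_vec (c v) - real_vec (c w)) = - ((A *v s) \<bullet> real_vec w) + (A *v s) \<bullet> real_vec v"
      if "v \<in> S" for v
      using that q(2) w by (simp add: inner_diff_right inner S_def)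
    then have "G ((D ** A) *v s) = (\<Sum>v\<in>S. of_real (q v) * (indicator period_cube ((D ** A) *v s) *\<^sub>R
        (iexp (- ((A *v s) \<bullet> real_vec w)) * iexp ((A *v s) \<bullet> real_vec v))))"
      unfolding G_def by (intro sum.cong refl) (simp add: exp_add[symmetric] ring_distribs)
    then show "G ((D ** A) *v s) = indicator period_cube ((D ** A) *v s) *\<^sub>R
      (iexp (- ((A *v s) \<bullet> real_vec w)) * char_fun q (A *v s))"
      by (simp add: char_fun_def S_def sum_distrib_left scaleR_sum_right mult_ac)
  qed
  finally show ?thesis by (simp add: scaleR_conv_of_real)
qed


section \<open>Steps generating a lattice\<close>

lemma sum_atMost_2: "(\<Sum>k\<le>(2::nat). f k) = f 0 + f 1 + f 2"
  by (simp add: numeral_2_eq_2)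

lemma one_minus_cos_ge:
  fixes x :: real
  assumes "\<bar>x\<bar> \<le> 1"
  shows "x\<^sup>2 / 4 \<le> 1 - cos x"
proof -
  have "\<bar>Re (iexp x - (\<Sum>k\<le>2. (\<i> * x) ^ k / fact k))\<bar> \<le> \<bar>x\<bar> ^ 3 / 6"
    using order_trans[OF abs_Re_le_cmod iexp_approx1[of x 2]] by (simp add: numeral_3_eq_3 fact_numeral)
  moreover have "Re (iexp x - (\<Sum>k\<le>2. (\<i> * x) ^ k / fact k)) = cos x - 1 + x\<^sup>2 / 2"
    by (simp add: sum_atMost_2 power_mult_distrib Re_exp)
  moreover have "\<bar>x\<bar> ^ 3 \<le> x\<^sup>2"
    using power_decreasing[of 2 3 "\<bar>x\<bar>"] assms by simp
  ultimately show ?thesis by linarith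
qed

text \<open>
  The contribution of one step value to the exponent \<open>(\<phi>(\<theta>) - 1) ln n\<close> at frequencies of order
  \<open>1 / sqrt (ln n)\<close>: a divergent phase of first order, and a limit of second order. Summed over the steps,
  the limit is the second moment, without subtraction of a squared mean.
\<close>

lemma iexp_second_order_tendsto:
  fixes \<tau> :: "nat \<Rightarrow> real"
  assumes "filterlim \<tau> at_top sequentially"
  shows "(\<lambda>n. (iexp (x / sqrt (\<tau> n)) - 1) * of_real (\<tau> n) - \<i> * of_real (sqrt (\<tau> n) * x))
    \<longlonglongrightarrow> of_real (- (x\<^sup>2 / 2))"
proof -
  have sq: "filterlim (\<lambda>n. sqrt (\<tau> n)) at_top sequentially"
    using sqrt_at_top assms by (rule filterlim_compose)
  have "(\<lambda>n. (iexp (x / sqrt (\<tau> n)) - 1) * of_real (\<tau> n) - \<i> * of_real (sqrt (\<tau> n) * x) - of_real (- (x\<^sup>2 / 2)))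
    \<longlonglongrightarrow> 0"
  proof (rule Lim_null_comparison)
    show "\<forall>\<^sub>F n in sequentially. norm ((iexp (x / sqrt (\<tau> n)) - 1) * of_real (\<tau> n) - \<i> * of_real (sqrt (\<tau> n) * x)
        - of_real (- (x\<^sup>2 / 2))) \<le> \<bar>x\<bar> ^ 3 / 6 / sqrt (\<tau> n)"
      using eventually_gt_at_top[of 0, THEN eventually_compose_filterlim, OF assms]
    proof eventually_elim
      case (elim n)
      define r where "r = sqrt (\<tau> n)"
      have r: "r > 0" "\<tau> n = r\<^sup>2" using elim by (auto simp: r_def)
      let ?h = "x / r"
      have sum: "(\<Sum>k\<le>2. (\<i> * ?h) ^ k / fact k) = 1 + \<i> * ?h - ?h\<^sup>2 / 2"
        by (simp add: sum_atMost_2 power_mult_distrib power_divide)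
      have "(iexp ?h - 1) * of_real (\<tau> n) - \<i> * of_real (r * x) - of_real (- (x\<^sup>2 / 2)) =
          (iexp ?h - (\<Sum>k\<le>2. (\<i> * ?h) ^ k / fact k)) * of_real (r\<^sup>2)"
        unfolding sum using r by (simp add: field_simps power2_eq_square)
      then have "norm ((iexp ?h - 1) * of_real (\<tau> n) - \<i> * of_real (r * x) - of_real (- (x\<^sup>2 / 2))) =
          norm (iexp ?h - (\<Sum>k\<le>2. (\<i> * ?h) ^ k / fact k)) * r\<^sup>2"
        by (simp only: norm_mult norm_of_real) simp
      also have "\<dots> \<le> (\<bar>?h\<bar> ^ Suc 2 / fact (Suc 2)) * r\<^sup>2"
        by (intro mult_right_mono iexp_approx1) simp
      also have "\<dots> = \<bar>x\<bar> ^ 3 / 6 / r"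
        using r(1) by (simp add: abs_divide power_divide fact_numeral eval_nat_numeral)
      finally show ?case by (simp add: r_def)
    qed
    show "(\<lambda>n. \<bar>x\<bar> ^ 3 / 6 / sqrt (\<tau> n)) \<longlonglongrightarrow> 0"
      by (intro real_tendsto_divide_at_top[OF tendsto_const sq])
  qed
  then show ?thesis by (rule LIM_zero_cancel)
qed

text \<open>
  The properties of the step distribution and its lattice that the Fourier argument needs. The assumption
  \<open>aperiodic\<close> is the dual form of minimality: a character that is trivial on the steps is trivial on
  \<open>L\<close>.
\<close>

locale lattice_step =
  fixes p :: "int ^ 'd \<Rightarrow> real" and B :: "(int ^ 'd) set"
    and L :: "(real ^ 'd) set" and D :: "real ^ 'd ^ 'd"
    and \<mu> :: "real ^ 'd" and \<Sigma> :: "real ^ 'd ^ 'd"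
  assumes finite_B: "finite B" and p_support: "\<And>u. p u \<noteq> 0 \<Longrightarrow> u \<in> B"
    and p_nonneg: "\<And>u. p u \<ge> 0" and p_sum: "(\<Sum>u\<in>B. p u) = 1"
    and mean: "\<mu> = (\<Sum>u\<in>B. p u *\<^sub>R real_vec u)"
    and moment: "\<And>x. (\<Sigma> *v x) \<bullet> x = (\<Sum>u\<in>B. p u * (x \<bullet> real_vec u)\<^sup>2)"
    and pos_def_moment: "pos_def \<Sigma>"
    and basis: "int_basis D L"
    and steps_in_lattice: "\<And>u. p u \<noteq> 0 \<Longrightarrow> real_vec u \<in> L"
    and aperiodic: "\<And>\<theta> z. (\<And>u. p u \<noteq> 0 \<Longrightarrow> \<exists>k::int. \<theta> \<bullet> real_vec u = of_int k * (2 * pi)) \<Longrightarrow> z \<in> L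
      \<Longrightarrow> \<exists>k::int. \<theta> \<bullet> z = of_int k * (2 * pi)"
begin

lemma char_fun_p: "char_fun p \<theta> = (\<Sum>u\<in>B. of_real (p u) * iexp (\<theta> \<bullet> real_vec u))"
  by (rule char_fun_eq_sum[OF finite_B p_support])

lemma p_support_sum: "(\<Sum>u | p u \<noteq> 0. p u) = 1"
  using p_sum finite_B p_support by (subst sum.mono_neutral_left[of B]) auto

lemma norm_char_fun_p_le: "cmod (char_fun p \<theta>) \<le> 1"
  by (rule norm_char_fun_le[OF p_nonneg p_support_sum])

lemma one_minus_Re_char_fun: "1 - Re (char_fun p \<theta>) = (\<Sum>u\<in>B. p u * (1 - cos (\<theta> \<bullet> real_vec u)))"
  by (simp add: char_fun_p Re_exp sum_subtractf right_diff_distrib p_sum)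

text \<open>
  If the basis were degenerate, all steps would lie in a hyperplane and \<open>\<Sigma>\<close> would be singular.
\<close>

lemma basis_det_nonzero: "det D \<noteq> 0"
proof
  assume "det D = 0"
  then have "\<not> invertible D" by (simp add: invertible_det_nz)
  then obtain \<theta> where \<theta>: "D *v \<theta> = 0" "\<theta> \<noteq> 0"
    by (auto simp: invertible_left_inverse matrix_left_invertible_ker)
  have "\<theta> \<bullet> real_vec u = 0" if nz: "p u \<noteq> 0" for u
  proof -
    obtain c where "real_vec u = real_vec c v* D"
      using steps_in_lattice[OF nz] basis by (auto simp: int_basis_def bij_betw_def)
    then show ?thesis
      using \<theta>(1) by (simp add: inner_commute[of \<theta>] dot_lmul_matrix)
  qed
  then have "(\<Sigma> *v \<theta>) \<bullet> \<theta> = 0"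
    unfolding moment by (intro sum.neutral) auto
  with pos_def_mult_vec(2)[OF pos_def_moment \<theta>(2)] show False by simp
qed

text \<open>
  The points \<open>\<theta>\<close> with \<open>D *v \<theta> \<in> period_cube\<close> form a fundamental domain of the lattice of all \<open>\<theta>\<close> whose
  inner products with \<open>L\<close> are multiples of \<open>2 \<pi>\<close>. Equality \<open>Re \<phi>(\<theta>) = 1\<close> puts \<open>\<theta>\<close> into that
  lattice, hence \<open>\<theta> = 0\<close>.
\<close>

lemma char_fun_gap_pos:
  assumes "D *v \<theta> \<in> period_cube" "\<theta> \<noteq> 0"
  shows "1 - Re (char_fun p \<theta>) > 0"
proof (rule ccontr)
  have nonneg: "0 \<le> p u * (1 - cos (\<theta> \<bullet> real_vec u))" for u
    by (simp add: p_nonneg)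
  assume "\<not> ?thesis"
  then have "(\<Sum>u\<in>B. p u * (1 - cos (\<theta> \<bullet> real_vec u))) = 0"
    unfolding one_minus_Re_char_fun using sum_nonneg[of B "\<lambda>u. p u * (1 - cos (\<theta> \<bullet> real_vec u))"] nonneg
    by force
  then have "p u * (1 - cos (\<theta> \<bullet> real_vec u)) = 0" if "u \<in> B" for u
    using that finite_B nonneg by (simp add: sum_nonneg_eq_0_iff)
  then have "\<exists>k::int. \<theta> \<bullet> real_vec u = of_int k * (2 * pi)" if "p u \<noteq> 0" for u
    using that p_support[OF that] by (force simp: cos_one_2pi_int mult.assoc)
  note lattice = aperiodic[OF this]
  have "(D *v \<theta>) $ i = 0" for i
  proof -
    have eq: "\<theta> \<bullet> (real_vec (axis i 1) v* D) = (D *v \<theta>) $ i"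
    proof -
      have "real_vec (axis i 1) = axis i 1"
        by (simp add: real_vec_def axis_def vec_eq_iff)
      then show ?thesis
        by (simp add: inner_commute[of \<theta>] dot_lmul_matrix inner_axis')
    qed
    have "real_vec (axis i 1) v* D \<in> L"
      using basis by (auto simp: int_basis_def bij_betw_def)
    from lattice[OF _ this] obtain k :: int where k: "(D *v \<theta>) $ i = of_int k * (2 * pi)"
      unfolding eq by blast
    have "\<bar>(D *v \<theta>) $ i\<bar> \<le> pi"
      using assms(1) by (auto simp: period_cube_def Basis_cart_eq inner_axis)
    then have "(2 * \<bar>of_int k\<bar>) * pi \<le> 1 * pi" by (simp add: k abs_mult)
    then have "2 * \<bar>of_int k :: real\<bar> \<le> 1"
      using pi_gt_zero by (rule mult_right_le_imp_le)
    then have "k = 0" by linarith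
    then show ?thesis using k by simp
  qed
  then have "D *v \<theta> = 0" by (simp add: vec_eq_iff)
  then have "\<theta> = 0"
    using basis_det_nonzero
    by (simp add: invertible_det_nz[symmetric] invertible_left_inverse matrix_left_invertible_ker)
  with assms(2) show False by simp
qed

text \<open>
  Near the origin the bound is the quadratic lower bound for \<open>1 - cos\<close>; on the compact remainder of the
  fundamental domain the quadratic form of \<open>\<Sigma>\<close> is bounded and \<open>1 - Re \<phi>(\<theta>)\<close> is bounded away
  from \<open>0\<close> by \<open>char_fun_gap_pos\<close>.
\<close>

lemma char_fun_gap:
  obtains \<kappa> where "\<kappa> > 0"
    "\<And>\<theta>. D *v \<theta> \<in> period_cube \<Longrightarrow> \<kappa> * ((\<Sigma> *v \<theta>) \<bullet> \<theta>) \<le> 1 - Re (char_fun p \<theta>)"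
proof -
  define K where "K = {\<theta>. D *v \<theta> \<in> period_cube}"
  define g where "g \<theta> = 1 - Re (char_fun p \<theta>)" for \<theta>
  define h where "h \<theta> = (\<Sigma> *v \<theta>) \<bullet> \<theta>" for \<theta>
  \<comment> \<open>In the ball of radius \<open>r\<close> all inner products with steps are at most \<open>1\<close>.\<close>
  define r where "r = 1 / (1 + (\<Sum>u\<in>B. norm (real_vec u)))"
  have norm_nonneg: "0 \<le> (\<Sum>u\<in>B. norm (real_vec u))" by (simp add: sum_nonneg)
  then have r: "r > 0" by (simp add: r_def)
  have near: "1 / 4 * h \<theta> \<le> g \<theta>" if "norm \<theta> \<le> r" for \<theta>
  proof -
    have "\<bar>\<theta> \<bullet> real_vec u\<bar> \<le> 1" if u: "u \<in> B" for u
    proof -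
      have "norm (real_vec u) \<le> (\<Sum>u\<in>B. norm (real_vec u))"
        using finite_B u by (intro member_le_sum) auto
      then have "norm \<theta> * norm (real_vec u) \<le> r * (1 + (\<Sum>u\<in>B. norm (real_vec u)))"
        using \<open>norm \<theta> \<le> r\<close> r by (intro mult_mono) auto
      also have "\<dots> = 1" using norm_nonneg by (simp add: r_def)
      finally show ?thesis using Cauchy_Schwarz_ineq2[of \<theta> "real_vec u"] by linarith
    qed
    then have "(\<Sum>u\<in>B. p u * ((\<theta> \<bullet> real_vec u)\<^sup>2 / 4)) \<le> (\<Sum>u\<in>B. p u * (1 - cos (\<theta> \<bullet> real_vec u)))"
      by (intro sum_mono mult_left_mono one_minus_cos_ge p_nonneg) auto
    then show ?thesis
      by (simp add: g_def h_def moment one_minus_Re_char_fun sum_divide_distrib)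
  qed
  obtain m where m: "m > 0" "\<And>\<theta>. \<theta> \<in> K \<Longrightarrow> norm \<theta> \<ge> r \<Longrightarrow> m * h \<theta> \<le> g \<theta>"
  proof -
    have "invertible D" using basis_det_nonzero by (simp add: invertible_det_nz)
    then have K: "K = (\<lambda>t. matrix_inv D *v t) ` period_cube"
      by (auto simp: K_def image_iff matrix_vector_mul_assoc matrix_inv_inverse
          intro!: bexI[of _ "D *v \<theta>" for \<theta>])
    have "compact K"
      unfolding K period_cube_eq_cbox
      by (intro compact_continuous_image compact_cbox matrix_vector_mult_linear_continuous_on)
    moreover have "closed {\<theta> :: real ^ 'd. r \<le> norm \<theta>}"
      by (intro closed_Collect_le continuous_intros)
    ultimately have C: "compact (K \<inter> {\<theta>. r \<le> norm \<theta>})" (is "compact ?C")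
      by (rule compact_Int_closed)
    show thesis
    proof (cases "?C = {}")
      case True
      then show thesis by (intro that[of 1]) auto
    next
      case False
      have "continuous_on ?C g" unfolding g_def by (intro continuous_intros)
      then obtain a where a: "a \<in> ?C" "\<And>\<theta>. \<theta> \<in> ?C \<Longrightarrow> g a \<le> g \<theta>"
        using continuous_attains_inf[OF C False] by blast
      have "continuous_on ?C h" unfolding h_def
        by (intro continuous_intros matrix_vector_mult_linear_continuous_on)
      then obtain b where b: "b \<in> ?C" "\<And>\<theta>. \<theta> \<in> ?C \<Longrightarrow> h \<theta> \<le> h b"
        using continuous_attains_sup[OF C False] by blast
      have "a \<noteq> 0" "b \<noteq> 0" using a(1) b(1) r by auto
      have "g a > 0"
        using a(1) \<open>a \<noteq> 0\<close> char_fun_gap_pos[of a] by (simp add: g_def K_def)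
      have "h b > 0"
        using pos_def_mult_vec(2)[OF pos_def_moment \<open>b \<noteq> 0\<close>] by (simp add: h_def)
      show thesis
      proof (rule that)
        show "g a / h b > 0" using \<open>g a > 0\<close> \<open>h b > 0\<close> by simp
        fix \<theta> assume "\<theta> \<in> K" "norm \<theta> \<ge> r"
        then have "\<theta> \<in> ?C" by simp
        have "g a / h b * h \<theta> \<le> g a / h b * h b"
          using b(2)[OF \<open>\<theta> \<in> ?C\<close>] \<open>g a > 0\<close> \<open>h b > 0\<close> by (intro mult_left_mono) auto
        also have "\<dots> = g a" using \<open>h b > 0\<close> by simp
        also have "\<dots> \<le> g \<theta>" by (rule a(2)[OF \<open>\<theta> \<in> ?C\<close>])
        finally show "g a / h b * h \<theta> \<le> g \<theta>" .
      qed
    qed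
  qed
  have h_nonneg: "h \<theta> \<ge> 0" for \<theta>
    unfolding h_def moment by (intro sum_nonneg mult_nonneg_nonneg p_nonneg) auto
  show thesis
  proof (rule that)
    show "min (1 / 4) m > 0" using m(1) by simp
    fix \<theta> assume "D *v \<theta> \<in> period_cube"
    then have "\<theta> \<in> K" by (simp add: K_def)
    have "min (1 / 4) m * h \<theta> \<le> 1 / 4 * h \<theta>"
      by (rule mult_right_mono[OF _ h_nonneg]) simp
    moreover have "min (1 / 4) m * h \<theta> \<le> m * h \<theta>"
      by (rule mult_right_mono[OF _ h_nonneg]) simp
    ultimately have "min (1 / 4) m * h \<theta> \<le> g \<theta>"
      using near[of \<theta>] m(2)[OF \<open>\<theta> \<in> K\<close>] by (cases "norm \<theta> \<le> r") auto
    then show "min (1 / 4) m * ((\<Sigma> *v \<theta>) \<bullet> \<theta>) \<le> 1 - Re (char_fun p \<theta>)"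
      by (simp add: g_def h_def)
  qed
qed

lemma char_fun_second_order_tendsto:
  assumes "filterlim \<tau> at_top sequentially"
  shows "(\<lambda>n. (char_fun p ((1 / sqrt (\<tau> n)) *\<^sub>R y) - 1) * of_real (\<tau> n) - \<i> * of_real (sqrt (\<tau> n) * (\<mu> \<bullet> y)))
    \<longlonglongrightarrow> of_real (- ((\<Sigma> *v y) \<bullet> y) / 2)"
proof -
  have "(\<lambda>n. \<Sum>u\<in>B. of_real (p u) * ((iexp ((y \<bullet> real_vec u) / sqrt (\<tau> n)) - 1) * of_real (\<tau> n)
      - \<i> * of_real (sqrt (\<tau> n) * (y \<bullet> real_vec u))))
    \<longlonglongrightarrow> (\<Sum>u\<in>B. of_real (p u) * of_real (- ((y \<bullet> real_vec u)\<^sup>2 / 2)))"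
    by (intro tendsto_sum tendsto_mult tendsto_const iexp_second_order_tendsto assms)
  moreover have "(\<Sum>u\<in>B. complex_of_real (p u) * of_real (- ((y \<bullet> real_vec u)\<^sup>2 / 2))) = of_real (- ((\<Sigma> *v y) \<bullet> y) / 2)"
    by (simp add: moment sum_divide_distrib sum_negf)
  moreover have "(\<Sum>u\<in>B. of_real (p u) * ((iexp ((y \<bullet> real_vec u) / sqrt (\<tau> n)) - 1) * of_real (\<tau> n)
      - \<i> * of_real (sqrt (\<tau> n) * (y \<bullet> real_vec u)))) =
      (char_fun p ((1 / sqrt (\<tau> n)) *\<^sub>R y) - 1) * of_real (\<tau> n) - \<i> * of_real (sqrt (\<tau> n) * (\<mu> \<bullet> y))" for n
  proof -
    have "(1 :: complex) = (\<Sum>u\<in>B. of_real (p u))"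
      using p_sum by (metis of_real_1 of_real_sum)
    then have "char_fun p ((1 / sqrt (\<tau> n)) *\<^sub>R y) - 1 =
        (\<Sum>u\<in>B. of_real (p u) * (iexp ((y \<bullet> real_vec u) / sqrt (\<tau> n)) - 1))"
      by (simp add: char_fun_p sum_subtractf right_diff_distrib)
    moreover have "\<mu> \<bullet> y = (\<Sum>u\<in>B. p u * (y \<bullet> real_vec u))"
      unfolding mean inner_sum_left by (intro sum.cong) (simp_all add: inner_commute)
    ultimately show ?thesis
      by (simp add: sum_distrib_left sum_distrib_right sum_subtractf right_diff_distrib mult_ac)
  qed
  ultimately show ?thesis by simp
qed

end


section \<open>The local limit for lattice laws\<close>

text \<open>
  With \<open>R = Q\<^sup>-\<^sup>1\<close>, inversion at the frequency \<open>\<theta> = A n *v s = R s / sqrt (ln n)\<close> splits the phase as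
  \<open>\<langle>\<theta>, w\<rangle> = \<langle>s, x\<rangle> + sqrt (ln n) \<langle>\<mu>, R s\<rangle>\<close>, where \<open>x\<close> is the scaled and centered position
  of \<open>w\<close>. The second part goes into the function \<open>G n\<close>, which then depends neither on \<open>w\<close> nor on \<open>x\<close>;
  this is what makes the error bound uniform.
\<close>

lemma (in lattice_step) lattice_local_limit:
  fixes q :: "nat \<Rightarrow> int ^ 'd \<Rightarrow> real" and init :: "int ^ 'd \<Rightarrow> real" and Q :: "real ^ 'd ^ 'd"
  assumes q0: "\<And>v. init v \<ge> 0" "(\<Sum>v | init v \<noteq> 0. init v) = 1"
    and q: "\<And>n. finite {v. q n v \<noteq> 0}" "\<And>n v. q n v \<noteq> 0 \<Longrightarrow> real_vec v \<in> L"
    and char_fun_q: "\<And>n \<theta>. char_fun (q n) \<theta> = char_fun init \<theta> * urn_product n (char_fun p \<theta>)"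
    and Q: "pos_def Q" "Q ** Q = \<Sigma>"
  obtains \<epsilon> where "\<epsilon> \<longlonglongrightarrow> 0"
    "\<And>n w. n \<ge> 2 \<Longrightarrow> real_vec w \<in> L \<Longrightarrow>
      \<bar>det Q * sqrt (ln (real n)) ^ CARD('d) / \<bar>det D\<bar> * q n w
        - std_gaussian_density (((1 / sqrt (ln (real n))) *\<^sub>R (real_vec w - ln (real n) *\<^sub>R \<mu>)) v* matrix_inv Q)\<bar>
      \<le> \<epsilon> n"
proof -
  define R where "R = matrix_inv Q"
  define r where "r n = sqrt (ln (real n))" for n
  define A where "A n = mat (1 / r n) ** R" for n
  have r_sq: "(r n)\<^sup>2 = ln (real n)" if "n \<ge> 1" for n
    using that by (simp add: r_def)
  have r_pos: "r n > 0" if "n \<ge> 2" for n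
    using that by (simp add: r_def)
  have invQ: "invertible Q" by (rule pos_def_invertible[OF Q(1)])
  have QR: "Q *v (R *v s) = s" for s
    by (simp add: R_def matrix_vector_mul_assoc matrix_inv_inverse[OF invQ])
  have det_Q: "det Q > 0" by (rule det_pos_def_pos[OF Q(1)])
  have det_R: "det R = 1 / det Q"
    using arg_cong[OF matrix_inv_inverse(1)[OF invQ], of det] det_Q
    by (simp add: det_mul R_def field_simps)
  have A: "A n *v s = (1 / r n) *\<^sub>R (R *v s)" for n s
    by (simp add: A_def matrix_vector_mul_assoc[symmetric] mat_mult_vec)
  have quad: "(\<Sigma> *v (R *v s)) \<bullet> (R *v s) = (norm s)\<^sup>2" for s
  proof -
    have "(\<Sigma> *v (R *v s)) \<bullet> (R *v s) = (Q *v (Q *v (R *v s))) \<bullet> (R *v s)"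
      by (simp add: Q(2)[symmetric] matrix_vector_mul_assoc matrix_mul_assoc)
    also have "\<dots> = s \<bullet> s" by (simp add: QR pos_def_mult_vec(3)[OF Q(1)])
    finally show ?thesis by (simp add: power2_norm_eq_inner)
  qed
  define G where "G n s = indicator period_cube (D *v (A n *v s)) *\<^sub>R
    (iexp (- (r n * (\<mu> \<bullet> (R *v s)))) * char_fun (q n) (A n *v s))" for n s
  define g where "g s = complex_of_real (exp (- (norm s)\<^sup>2 / 2))" for s :: "real ^ 'd"
  define \<epsilon> where "\<epsilon> n = (\<integral>s. cmod (G n s - g s) \<partial>lborel) / (2 * pi) ^ CARD('d)" for n

  have G_meas [measurable]: "G n \<in> borel_measurable borel" for n
  proof -
    have "(\<lambda>s. D *v (A n *v s)) \<in> borel_measurable borel"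
      by (intro borel_measurable_continuous_onI continuous_on_compose2[OF matrix_vector_mult_linear_continuous_on
            matrix_vector_mult_linear_continuous_on]) auto
    then have "(\<lambda>s. indicat_real period_cube (D *v (A n *v s))) \<in> borel_measurable borel"
      by (rule measurable_compose) simp
    moreover have "(\<lambda>s. iexp (- (r n * (\<mu> \<bullet> (R *v s)))) * char_fun (q n) (A n *v s)) \<in> borel_measurable borel"
      by (intro borel_measurable_continuous_onI continuous_intros)
    ultimately show ?thesis
      unfolding G_def by (intro borel_measurable_scaleR)
  qed
  have g_meas [measurable]: "g \<in> borel_measurable borel"
    unfolding g_def by measurable
  have g_int: "integrable lborel g"
    using integrable_exp_neg_norm_square[of "1/2"] unfolding g_def by (intro integrable_of_real) simp

  obtain C where C: "C > 0" "\<And>n z. n \<ge> 1 \<Longrightarrow> cmod z \<le> 1 \<Longrightarrow>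
      cmod (urn_product n z) \<le> C * exp (- (1 - Re z) * ln (real n))"
    by (rule norm_urn_product_le) blast
  obtain \<kappa> where \<kappa>: "\<kappa> > 0"
    "\<And>\<theta>. D *v \<theta> \<in> period_cube \<Longrightarrow> \<kappa> * ((\<Sigma> *v \<theta>) \<bullet> \<theta>) \<le> 1 - Re (char_fun p \<theta>)"
    by (rule char_fun_gap) blast
  have G_bound: "cmod (G n s) \<le> C * exp (- \<kappa> * (norm s)\<^sup>2)" if n: "n \<ge> 2" for n s
  proof (cases "D *v (A n *v s) \<in> period_cube")
    case True
    have "(\<Sigma> *v (A n *v s)) \<bullet> (A n *v s) = (norm s)\<^sup>2 / ln (real n)"
      using n by (simp add: A matrix_vector_mult_scaleR quad r_sq[symmetric] power2_eq_square)
    with \<kappa>(2)[OF True] have "\<kappa> * ((norm s)\<^sup>2 / ln (real n)) \<le> 1 - Re (char_fun p (A n *v s))"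
      by simp
    then have "\<kappa> * (norm s)\<^sup>2 \<le> (1 - Re (char_fun p (A n *v s))) * ln (real n)"
      using n by (simp add: field_simps)
    then have "exp (- (1 - Re (char_fun p (A n *v s))) * ln (real n)) \<le> exp (- \<kappa> * (norm s)\<^sup>2)"
      by (simp add: algebra_simps)
    then have "C * exp (- (1 - Re (char_fun p (A n *v s))) * ln (real n)) \<le> C * exp (- \<kappa> * (norm s)\<^sup>2)"
      using C(1) by (intro mult_left_mono) auto
    moreover have "cmod (urn_product n (char_fun p (A n *v s)))
        \<le> C * exp (- (1 - Re (char_fun p (A n *v s))) * ln (real n))"
      using n by (intro C(2) norm_char_fun_p_le) simp
    ultimately have "cmod (urn_product n (char_fun p (A n *v s))) \<le> C * exp (- \<kappa> * (norm s)\<^sup>2)"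
      by (rule order_trans[rotated])
    moreover have "cmod (char_fun init (A n *v s)) \<le> 1"
      by (rule norm_char_fun_le[OF q0])
    ultimately have "cmod (char_fun init (A n *v s)) * cmod (urn_product n (char_fun p (A n *v s)))
        \<le> 1 * (C * exp (- \<kappa> * (norm s)\<^sup>2))"
      by (intro mult_mono) auto
    then show ?thesis
      using True by (simp add: G_def norm_mult char_fun_q)
  next
    case False
    then show ?thesis using C(1) by (simp add: G_def)
  qed
  have bound_int: "integrable lborel (\<lambda>s::real ^ 'd. C * exp (- \<kappa> * (norm s)\<^sup>2))"
    using integrable_exp_neg_norm_square[OF \<kappa>(1)] by (intro integrable_mult_right)
  have G_int: "integrable lborel (G n)" if "n \<ge> 2" for n
    using G_bound[OF that] C(1) by (intro Bochner_Integration.integrable_bound[OF bound_int]) auto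

  have ln_top: "filterlim (\<lambda>n. ln (real n)) at_top sequentially"
    by (rule filterlim_compose[OF ln_at_top filterlim_real_sequentially])
  have r_inv: "(\<lambda>n. 1 / r n) \<longlonglongrightarrow> 0"
    unfolding r_def
    by (intro real_tendsto_divide_at_top[OF tendsto_const] filterlim_compose[OF sqrt_at_top ln_top])
  have A_tendsto: "(\<lambda>n. A n *v s) \<longlonglongrightarrow> 0" for s
    using tendsto_scaleR[OF r_inv tendsto_const[of "R *v s"]] by (simp add: A)
  have char_fun_A: "(\<lambda>n. char_fun q' (A n *v s)) \<longlonglongrightarrow> char_fun q' 0" for q' :: "int ^ 'd \<Rightarrow> real" and s
    using continuous_on_tendsto_compose[OF continuous_on_char_fun[OF continuous_on_id, of UNIV q'] A_tendsto[of s]]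
    by simp
  have G_tendsto: "(\<lambda>n. G n s) \<longlonglongrightarrow> g s" for s
  proof -
    have p0: "char_fun p 0 = 1" and q00: "char_fun init 0 = 1"
      using p_support_sum q0(2) by (simp_all add: char_fun_def of_real_sum[symmetric])
    have "(\<lambda>n. D *v (A n *v s)) \<longlonglongrightarrow> D *v 0"
      using continuous_on_tendsto_compose[OF matrix_vector_mult_linear_continuous_on[of UNIV D] A_tendsto[of s]]
      by simp
    then have "(\<lambda>n. D *v (A n *v s)) \<longlonglongrightarrow> 0" by simp
    moreover have "open (ball (0 :: real ^ 'd) pi)" "0 \<in> ball (0 :: real ^ 'd) pi" by auto
    ultimately have "\<forall>\<^sub>F n in sequentially. D *v (A n *v s) \<in> ball 0 pi"
      by (rule topological_tendstoD)
    then have "\<forall>\<^sub>F n in sequentially. indicat_real period_cube (D *v (A n *v s)) = 1"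
    proof eventually_elim
      case (elim n)
      then have "\<bar>(D *v (A n *v s)) \<bullet> b\<bar> \<le> pi" if "b \<in> Basis" for b
        using Basis_le_norm[OF that, of "D *v (A n *v s)"] by simp
      then show ?case by (simp add: period_cube_def)
    qed
    then have ind: "(\<lambda>n. indicat_real period_cube (D *v (A n *v s))) \<longlonglongrightarrow> 1"
      by (rule tendsto_eventually)
    have "(\<lambda>n. urn_product n (char_fun p (A n *v s)) * iexp (- (r n * (\<mu> \<bullet> (R *v s)))))
        \<longlonglongrightarrow> exp (of_real (- ((\<Sigma> *v (R *v s)) \<bullet> (R *v s)) / 2))"
    proof (rule urn_product_tendsto)
      show "(\<lambda>n. char_fun p (A n *v s)) \<longlonglongrightarrow> 1"
        using char_fun_A[of p s] by (simp add: p0)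
      show "(\<lambda>n. (char_fun p (A n *v s) - 1) * of_real (ln (real n)) - \<i> * of_real (r n * (\<mu> \<bullet> (R *v s))))
        \<longlonglongrightarrow> of_real (- ((\<Sigma> *v (R *v s)) \<bullet> (R *v s)) / 2)"
        unfolding A unfolding r_def by (rule char_fun_second_order_tendsto[OF ln_top])
    qed (rule norm_char_fun_p_le)
    then have prod: "(\<lambda>n. urn_product n (char_fun p (A n *v s)) * iexp (- (r n * (\<mu> \<bullet> (R *v s))))) \<longlonglongrightarrow> g s"
      by (simp add: quad g_def exp_of_real[symmetric])
    have "(\<lambda>n. indicat_real period_cube (D *v (A n *v s)) *\<^sub>R (char_fun init (A n *v s) *
        (urn_product n (char_fun p (A n *v s)) * iexp (- (r n * (\<mu> \<bullet> (R *v s))))))) \<longlonglongrightarrow> 1 *\<^sub>R (char_fun init 0 * g s)"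
      by (intro tendsto_scaleR tendsto_mult ind prod char_fun_A)
    then show ?thesis
      by (simp add: G_def char_fun_q q00 mult_ac)
  qed

  \<comment> \<open>The shift by 2 excludes the times with \<open>ln n \<le> 0\<close>, where \<open>G n\<close> is not dominated.\<close>
  have "(\<lambda>n. \<integral>s. cmod (G (n + 2) s - g s) \<partial>lborel) \<longlonglongrightarrow> (\<integral>s. 0 \<partial>(lborel :: (real ^ 'd) measure))"
  proof (rule integral_dominated_convergence)
    show "integrable lborel (\<lambda>s. C * exp (- \<kappa> * (norm s)\<^sup>2) + cmod (g s))"
      by (intro Bochner_Integration.integrable_add bound_int integrable_norm g_int)
    show "AE s in lborel. (\<lambda>n. cmod (G (n + 2) s - g s)) \<longlonglongrightarrow> 0"
    proof (intro AE_I2)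
      fix s
      have "(\<lambda>n. cmod (G n s - g s)) \<longlonglongrightarrow> 0"
        using G_tendsto[of s] by (simp add: LIM_zero_iff tendsto_norm_zero_iff)
      then show "(\<lambda>n. cmod (G (n + 2) s - g s)) \<longlonglongrightarrow> 0"
        by (rule LIMSEQ_ignore_initial_segment)
    qed
    show "AE s in lborel. norm (cmod (G (n + 2) s - g s)) \<le> C * exp (- \<kappa> * (norm s)\<^sup>2) + cmod (g s)" for n
    proof (intro AE_I2)
      fix s
      show "norm (cmod (G (n + 2) s - g s)) \<le> C * exp (- \<kappa> * (norm s)\<^sup>2) + cmod (g s)"
        using norm_triangle_ineq4[of "G (n + 2) s" "g s"] G_bound[of "n + 2" s] by simp
    qed
  qed measurable
  then have "(\<lambda>n. \<epsilon> (n + 2)) \<longlonglongrightarrow> 0"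
    unfolding \<epsilon>_def by (intro tendsto_divide_zero) simp
  then have "\<epsilon> \<longlonglongrightarrow> 0" by (rule LIMSEQ_offset)
  moreover have "\<bar>det Q * r n ^ CARD('d) / \<bar>det D\<bar> * q n w
      - std_gaussian_density (((1 / r n) *\<^sub>R (real_vec w - ln (real n) *\<^sub>R \<mu>)) v* R)\<bar> \<le> \<epsilon> n"
    if n: "n \<ge> 2" and w: "real_vec w \<in> L" for n w
  proof -
    define x where "x = ((1 / r n) *\<^sub>R (real_vec w - ln (real n) *\<^sub>R \<mu>)) v* R"
    have "s \<bullet> x = (A n *v s) \<bullet> real_vec w - r n * (\<mu> \<bullet> (R *v s))" for s
    proof -
      have "s \<bullet> x = (1 / r n) * (real_vec w \<bullet> (R *v s)) - (ln (real n) / r n) * (\<mu> \<bullet> (R *v s))"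
        by (simp add: x_def inner_commute[of s] dot_lmul_matrix inner_diff_left field_simps)
      also have "ln (real n) / r n = r n"
        using n r_pos[OF n] r_sq[of n] by (simp add: power2_eq_square field_simps)
      finally show ?thesis by (simp add: A inner_commute)
    qed
    then have iexp_x: "iexp (- ((A n *v s) \<bullet> real_vec w)) = iexp (- (s \<bullet> x)) * iexp (- (r n * (\<mu> \<bullet> (R *v s))))" for s
      by (simp add: exp_add[symmetric] ring_distribs)
    have det_DA: "\<bar>det (D ** A n)\<bar> = \<bar>det D\<bar> / (det Q * r n ^ CARD('d))"
      using det_Q r_pos[OF n]
      by (simp add: A_def det_mul det_mat det_R abs_mult power_one_over field_simps)
    have l: "\<bar>det D\<bar> > 0" using basis_det_nonzero by simp
    have "\<bar>det (D ** A n)\<bar> > 0"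
      unfolding det_DA using l det_Q r_pos[OF n] by simp
    then have "det (D ** A n) \<noteq> 0" by simp
    then have inversion: "of_real ((2 * pi) ^ CARD('d) * q n w) = of_real \<bar>det (D ** A n)\<bar> *
      (\<integral>s. indicator period_cube ((D ** A n) *v s) *\<^sub>R
        (iexp (- ((A n *v s) \<bullet> real_vec w)) * char_fun (q n) (A n *v s)) \<partial>lborel)"
      using q w by (intro lattice_fourier_inversion[OF basis])
    have "indicator period_cube ((D ** A n) *v s) *\<^sub>R (iexp (- ((A n *v s) \<bullet> real_vec w)) * char_fun (q n) (A n *v s))
        = iexp (- (s \<bullet> x)) * G n s" for s
      unfolding iexp_x G_def matrix_vector_mul_assoc[symmetric] scaleR_conv_of_real by (simp only: mult_ac)
    then have "of_real ((2 * pi) ^ CARD('d) * q n w) = of_real \<bar>det (D ** A n)\<bar> *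
      (\<integral>s. iexp (- (s \<bullet> x)) * G n s \<partial>lborel)"
      using inversion by (simp only:)
    then have "of_real ((2 * pi) ^ CARD('d) * (det Q * r n ^ CARD('d) / \<bar>det D\<bar> * q n w)) =
      (\<integral>s. iexp (- (s \<bullet> x)) * G n s \<partial>lborel)"
      unfolding det_DA using l det_Q r_pos[OF n] by (simp add: field_simps)
    moreover have "of_real ((2 * pi) ^ CARD('d) * std_gaussian_density x) = (\<integral>s. iexp (- (s \<bullet> x)) * g s \<partial>lborel)"
      using gaussian_fourier_integral[of x] by (simp add: g_def exp_of_real[symmetric])
    moreover have iexp_int: "integrable lborel (\<lambda>s. iexp (- (s \<bullet> x)) * f s)" if f: "integrable lborel f" for f
    proof (rule Bochner_Integration.integrable_bound[OF f])
      have [measurable]: "f \<in> borel_measurable borel" using f by simp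
      show "(\<lambda>s. iexp (- (s \<bullet> x)) * f s) \<in> borel_measurable lborel" by measurable
    qed (simp add: norm_mult)
    ultimately have "complex_of_real ((2 * pi) ^ CARD('d) *
        (det Q * r n ^ CARD('d) / \<bar>det D\<bar> * q n w - std_gaussian_density x)) =
        (\<integral>s. iexp (- (s \<bullet> x)) * G n s - iexp (- (s \<bullet> x)) * g s \<partial>lborel)"
      using G_int[OF n] g_int
      by (subst Bochner_Integration.integral_diff) (simp_all add: right_diff_distrib)
    also have "cmod \<dots> \<le> (\<integral>s. cmod (iexp (- (s \<bullet> x)) * G n s - iexp (- (s \<bullet> x)) * g s) \<partial>lborel)"
      by (rule integral_norm_bound)
    also have "\<dots> = (\<integral>s. cmod (G n s - g s) \<partial>lborel)"
      by (simp add: right_diff_distrib[symmetric] norm_mult)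
    finally have "(2 * pi) ^ CARD('d) * \<bar>det Q * r n ^ CARD('d) / \<bar>det D\<bar> * q n w - std_gaussian_density x\<bar>
        \<le> (\<integral>s. cmod (G n s - g s) \<partial>lborel)"
      by (simp only: norm_of_real abs_mult) simp
    then show ?thesis
      unfolding \<epsilon>_def x_def[symmetric] by (simp add: pos_le_divide_eq mult.commute)
  qed
  ultimately show thesis
    unfolding r_def R_def by (rule that)
qed


section \<open>From the probabilistic hypotheses to the local limit\<close>

context prob_space
begin

lemma expectation_finite_support:
  fixes Y :: "'a \<Rightarrow> int ^ 'd" and f :: "int ^ 'd \<Rightarrow> 'b::{banach,second_countable_topology}"
  assumes Y: "Y \<in> measurable M (count_space UNIV)"
    and B: "finite B" "\<And>u. u \<notin> B \<Longrightarrow> mass_fun M Y u = 0"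
  shows "(\<integral>\<omega>. f (Y \<omega>) \<partial>M) = (\<Sum>u\<in>B. mass_fun M Y u *\<^sub>R f u)"
proof -
  have sets: "{\<omega> \<in> space M. Y \<omega> = u} \<in> events" for u
    using measurable_sets[OF Y, of "{u}"] by (simp add: vimage_def Int_def conj_commute)
  have "AE \<omega> in M. \<forall>u. u \<notin> B \<longrightarrow> Y \<omega> \<noteq> u"
  proof (subst AE_all_countable, intro allI)
    fix u
    show "AE \<omega> in M. u \<notin> B \<longrightarrow> Y \<omega> \<noteq> u"
    proof (cases "u \<in> B")
      case False
      then have "emeasure M {\<omega> \<in> space M. Y \<omega> = u} = 0"
        using B(2) by (simp add: emeasure_eq_measure mass_fun_def)
      then have "AE \<omega> in M. Y \<omega> \<noteq> u"
        using sets[of u] by (subst AE_iff_measurable[of "{\<omega> \<in> space M. Y \<omega> = u}"]) auto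
      then show ?thesis by simp
    qed simp
  qed
  then have "AE \<omega> in M. f (Y \<omega>) = (\<Sum>u\<in>B. indicat_real {\<omega> \<in> space M. Y \<omega> = u} \<omega> *\<^sub>R f u)"
    using AE_space
  proof eventually_elim
    case (elim \<omega>)
    then have "Y \<omega> \<in> B" by blast
    have "(\<Sum>u\<in>B. indicat_real {\<omega> \<in> space M. Y \<omega> = u} \<omega> *\<^sub>R f u) = (\<Sum>u\<in>B. if u = Y \<omega> then f u else 0)"
      using elim(2) by (intro sum.cong) (auto simp: indicator_def)
    then show ?case using B(1) \<open>Y \<omega> \<in> B\<close> by simp
  qed
  then have "(\<integral>\<omega>. f (Y \<omega>) \<partial>M) = (\<integral>\<omega>. (\<Sum>u\<in>B. indicat_real {\<omega> \<in> space M. Y \<omega> = u} \<omega> *\<^sub>R f u) \<partial>M)"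
    using sets by (intro integral_cong_AE measurable_compose[OF Y]) auto
  also have "\<dots> = (\<Sum>u\<in>B. \<integral>\<omega>. indicat_real {\<omega> \<in> space M. Y \<omega> = u} \<omega> *\<^sub>R f u \<partial>M)"
    using sets by (intro Bochner_Integration.integral_sum integrable_scaleR_left integrable_real_indicator)
      (auto simp: less_top[symmetric])
  also have "\<dots> = (\<Sum>u\<in>B. mass_fun M Y u *\<^sub>R f u)"
    using sets by (intro sum.cong refl) (simp add: mass_fun_def less_top[symmetric])
  finally show ?thesis .
qed

lemma sum_mass_fun:
  fixes Y :: "'a \<Rightarrow> int ^ 'd"
  assumes "Y \<in> measurable M (count_space UNIV)" "finite B" "\<And>u. u \<notin> B \<Longrightarrow> mass_fun M Y u = 0"
  shows "(\<Sum>u\<in>B. mass_fun M Y u) = 1"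
  using expectation_finite_support[OF assms, of "\<lambda>_. 1 :: real"] by (simp add: prob_space)

text \<open>
  Turns the statements about cosets of probability one into statements about the finitely many atoms,
  which is the form in which the minimality of the lattice is used.
\<close>

lemma prob_in_coset_eq_1_iff:
  fixes Y :: "'a \<Rightarrow> int ^ 'd"
  assumes Y: "Y \<in> measurable M (count_space UNIV)"
    and B: "finite B" "\<And>u. u \<notin> B \<Longrightarrow> mass_fun M Y u = 0"
  shows "prob_in_coset M Y x L = 1 \<longleftrightarrow> (\<forall>u. mass_fun M Y u \<noteq> 0 \<longrightarrow> real_vec u - x \<in> L)"
proof -
  let ?m = "mass_fun M Y"
  have coset: "real_vec u \<in> (\<lambda>z. x + z) ` L \<longleftrightarrow> real_vec u - x \<in> L" for u
    by (auto intro!: image_eqI[of _ _ "real_vec u - x"])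
  have "{\<omega> \<in> space M. real_vec (Y \<omega>) \<in> (\<lambda>z. x + z) ` L} \<in> events"
    using measurable_sets[OF Y, of "{u. real_vec u \<in> (\<lambda>z. x + z) ` L}"]
    by (simp add: vimage_def Int_def conj_commute)
  then have "prob_in_coset M Y x L = (\<integral>\<omega>. indicator {\<omega> \<in> space M. real_vec (Y \<omega>) \<in> (\<lambda>z. x + z) ` L} \<omega> \<partial>M)"
    by (simp add: prob_in_coset_def)
  also have "\<dots> = (\<integral>\<omega>. indicator {u. real_vec u - x \<in> L} (Y \<omega>) \<partial>M)"
    by (intro Bochner_Integration.integral_cong refl) (auto simp: indicator_def coset)
  also have "\<dots> = (\<Sum>u\<in>B. ?m u * indicator {u. real_vec u - x \<in> L} u)"
    by (subst expectation_finite_support[OF Y B]) simp_all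
  finally have "prob_in_coset M Y x L = 1 \<longleftrightarrow> (\<Sum>u\<in>B. ?m u * (1 - indicator {u. real_vec u - x \<in> L} u)) = 0"
    using sum_mass_fun[OF Y B] by (auto simp: right_diff_distrib sum_subtractf)
  also have "\<dots> \<longleftrightarrow> (\<forall>u\<in>B. ?m u * (1 - indicator {u. real_vec u - x \<in> L} u) = 0)"
    by (rule sum_nonneg_eq_0_iff) (auto simp: B(1) mass_fun_def indicator_def)
  also have "\<dots> \<longleftrightarrow> (\<forall>u. ?m u \<noteq> 0 \<longrightarrow> real_vec u - x \<in> L)"
    using B(2) by (auto simp: indicator_def)
  finally show ?thesis .
qed

end

text \<open>
  The quadratic form of \<open>\<Sigma>\<close> is the average of these squares over the steps.
\<close>

lemma outer_product_quadratic_form: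
  "((transpose (rowvector a :: real ^ 'd ^ 1) ** rowvector a) *v x) \<bullet> x = (x \<bullet> a)\<^sup>2"
proof -
  have "(transpose (rowvector a :: real ^ 'd ^ 1) ** rowvector a) *v x = (a \<bullet> x) *\<^sub>R a"
    by (simp add: vec_eq_iff matrix_vector_mult_def matrix_matrix_mult_def transpose_def rowvector_def
        inner_vec_def sum_distrib_left mult_ac)
  then show ?thesis by (simp add: power2_eq_square inner_commute)
qed

text \<open>
  The closed subgroups against which minimality of the lattice is tested: the integer vectors, and the
  vectors on which a given character is trivial.
\<close>

lemma closed_subgroup_Ints_preimage:
  fixes f :: "real ^ 'd \<Rightarrow> real"
  assumes "linear f"
  shows "closed_subgroup {x. f x \<in> \<int>}"
proof -
  have "closed (f -` \<int>)"
    using assms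
    by (intro continuous_closed_vimage closed_Ints linear_continuous_at) (simp add: linear_conv_bounded_linear)
  then show ?thesis
    using assms by (auto simp: closed_subgroup_def vimage_def linear_0 linear_add linear_neg)
qed

lemma closed_subgroup_Inter:
  "(\<And>i. closed_subgroup (L i)) \<Longrightarrow> closed_subgroup (\<Inter>i. L i)"
  by (auto simp: closed_subgroup_def)

lemma range_real_vec: "range real_vec = (\<Inter>i. {x :: real ^ 'd. x $ i \<in> \<int>})"
proof (intro set_eqI iffI)
  fix x :: "real ^ 'd"
  assume "x \<in> (\<Inter>i. {x. x $ i \<in> \<int>})"
  then have "x = real_vec (\<chi> i. \<lfloor>x $ i\<rfloor>)"
    by (simp add: real_vec_def vec_eq_iff)
  then show "x \<in> range real_vec" by blast
qed (auto simp: real_vec_def)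

lemma closed_subgroup_range_real_vec: "closed_subgroup (range real_vec :: (real ^ 'd) set)"
  unfolding range_real_vec
  by (intro closed_subgroup_Inter closed_subgroup_Ints_preimage linearI) simp_all

theorem theorem8:
  fixes N :: "'a measure" and X :: "nat \<Rightarrow> 'a \<Rightarrow> int ^ 'd"
    and B :: "(int ^ 'd) set"
    and M :: "'w measure"
    and p U0 :: "int ^ 'd \<Rightarrow> real"
    and U :: "nat \<Rightarrow> 'w \<Rightarrow> int ^ 'd \<Rightarrow> real"
    and Z :: "nat \<Rightarrow> 'w \<Rightarrow> int ^ 'd"
    and L :: "(real ^ 'd) set" and l :: real
    and x0 \<mu> :: "real ^ 'd"
    and \<Sigma> :: "real ^ 'd ^ 'd"
  assumes dim: "CARD('d) \<ge> 2"
    and iid: "iid_sequence N X"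
    and p: "p = mass_fun N (X 1)"
    and bounded: "finite B" "B \<noteq> {}" "\<And>u. u \<notin> B \<Longrightarrow> p u = 0"
    and mean: "\<mu> = mean_vec N (X 1)"
    and moment: "\<Sigma> = second_moment N (X 1)" "pos_def \<Sigma>"
    and urn: "urn_model M p U0 U Z"
    and lattice: "minimal_lattice N (X 1) L" "l = lattice_det L"
    and shift: "prob_in_coset N (X 1) x0 L = 1"
    and start: "\<And>v. U0 v \<noteq> 0 \<Longrightarrow> real_vec v \<in> L"
    and zero: "measure N {\<omega> \<in> space N. X 1 \<omega> = 0} > 0"
  shows "(\<lambda>n. SUP x \<in> scaled_lattice L x0 \<mu> (matrix_inv (pos_def_sqrt \<Sigma>)) n.
            \<bar>det (pos_def_sqrt \<Sigma>) * sqrt (ln (real n)) ^ CARD('d) / l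
               * measure M {\<omega> \<in> space M.
                   ((1 / sqrt (ln (real n))) *\<^sub>R (real_vec (Z n \<omega>) - ln (real n) *\<^sub>R \<mu>))
                     v* matrix_inv (pos_def_sqrt \<Sigma>) = x}
             - std_gaussian_density x\<bar>)
         \<longlonglongrightarrow> 0"
proof -
  interpret N: prob_space N using iid by (simp add: iid_sequence_def)
  interpret urn: urn_model M p U0 U Z by (rule urn)
  define Y where "Y = X 1"
  have Y: "Y \<in> measurable N (count_space UNIV)"
    unfolding Y_def using iid by (auto simp: iid_sequence_def N.indep_vars_def2)
  have massB: "\<And>u. u \<notin> B \<Longrightarrow> mass_fun N Y u = 0"
    using bounded(3) unfolding p Y_def .
  note finite_support = Y bounded(1) massB
  have coset_iff: "prob_in_coset N Y x L' = 1 \<longleftrightarrow> (\<forall>u. p u \<noteq> 0 \<longrightarrow> real_vec u - x \<in> L')" for x L'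
    unfolding p Y_def[symmetric] by (rule N.prob_in_coset_eq_1_iff[OF finite_support])
  have expect: "(\<integral>\<omega>. f (Y \<omega>) \<partial>N) = (\<Sum>u\<in>B. p u *\<^sub>R f u)"
    for f :: "int ^ 'd \<Rightarrow> 'c::{banach,second_countable_topology}"
    unfolding p Y_def[symmetric] by (rule N.expectation_finite_support[OF finite_support])
  have p0: "p 0 > 0" using zero unfolding p mass_fun_def .
  have subgroup: "closed_subgroup L" and minimal:
      "\<And>L' y. closed_subgroup L' \<Longrightarrow> prob_in_coset N Y (real_vec y) L' = 1 \<Longrightarrow> L \<subseteq> L'"
    using lattice(1) unfolding minimal_lattice_def Y_def by blast+
  have L: "0 \<in> L" "\<And>x y. x \<in> L \<Longrightarrow> y \<in> L \<Longrightarrow> x + y \<in> L" "\<And>x. x \<in> L \<Longrightarrow> - x \<in> L"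
    using subgroup by (auto simp: closed_subgroup_def)
  have steps: "real_vec u \<in> L" if "p u \<noteq> 0" for u
  proof -
    have "prob_in_coset N Y (real_vec 0) L = 1"
      using lattice(1) p0 unfolding minimal_lattice_def Y_def p by blast
    then show ?thesis using that by (simp add: coset_iff real_vec_zero)
  qed
  have "\<forall>u. p u \<noteq> 0 \<longrightarrow> real_vec u - x0 \<in> L"
    using shift unfolding coset_iff[symmetric] Y_def .
  then have "0 - x0 \<in> L"
    using p0 by (metis less_irrefl real_vec_zero)
  then have "x0 \<in> L" using L(3)[of "- x0"] by simp
  then have nx0: "real n *\<^sub>R x0 \<in> L" for n
    using L by (induction n) (auto simp: scaleR_left_distrib)
  \<comment> \<open>This makes every point of the scaled lattice the position of some integer vector, that is, of a color.\<close>
  have L_int: "L \<subseteq> range real_vec"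
    by (rule minimal[OF closed_subgroup_range_real_vec, of 0])
      (simp add: coset_iff real_vec_zero)
  define D where "D = (SOME D. int_basis D L)"
  have D: "int_basis D L"
    using lattice(1) unfolding D_def minimal_lattice_def by (metis someI_ex)
  have l: "l = \<bar>det D\<bar>" by (simp add: lattice(2) lattice_det_def D_def)

  interpret step: lattice_step p B L D \<mu> \<Sigma>
  proof
    show "finite B" by fact
    show "u \<in> B" if "p u \<noteq> 0" for u using bounded(3) that by blast
    show "0 \<le> p u" for u by (simp add: p mass_fun_def)
    show "(\<Sum>u\<in>B. p u) = 1" unfolding p Y_def[symmetric] by (rule N.sum_mass_fun[OF finite_support])
    show "\<mu> = (\<Sum>u\<in>B. p u *\<^sub>R real_vec u)"
      unfolding mean mean_vec_def Y_def[symmetric] by (rule expect)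
    show "(\<Sigma> *v x) \<bullet> x = (\<Sum>u\<in>B. p u * (x \<bullet> real_vec u)\<^sup>2)" for x
    proof -
      have "\<Sigma> = (\<Sum>u\<in>B. p u *\<^sub>R (transpose (rowvector (real_vec u) :: real ^ 'd ^ 1) ** rowvector (real_vec u)))"
        unfolding moment(1) second_moment_def Y_def[symmetric] by (rule expect)
      moreover have "((\<Sum>u\<in>S. p u *\<^sub>R (transpose (rowvector (real_vec u) :: real ^ 'd ^ 1) ** rowvector (real_vec u))) *v x) \<bullet> x
          = (\<Sum>u\<in>S. p u * (x \<bullet> real_vec u)\<^sup>2)" if "finite S" for S
        using that
        by induction (simp_all add: matrix_vector_mult_add_rdistrib inner_add_left
            scaleR_matrix_vector_assoc[symmetric] outer_product_quadratic_form)
      ultimately show ?thesis using bounded(1) by simp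
    qed
    show "pos_def \<Sigma>" by fact
    show "int_basis D L" by fact
    show "real_vec u \<in> L" if "p u \<noteq> 0" for u using that by (rule steps)
    show "\<exists>k::int. \<theta> \<bullet> z = of_int k * (2 * pi)"
      if periods: "\<And>u. p u \<noteq> 0 \<Longrightarrow> \<exists>k::int. \<theta> \<bullet> real_vec u = of_int k * (2 * pi)" and z: "z \<in> L" for \<theta> z
    proof -
      \<comment> \<open>The character with frequency \<open>\<theta>\<close> is trivial exactly on this closed subgroup.\<close>
      let ?L' = "{x. (\<theta> \<bullet> x) / (2 * pi) \<in> \<int>}"
      have "closed_subgroup ?L'"
        by (intro closed_subgroup_Ints_preimage linearI) (simp_all add: inner_add_right add_divide_distrib)
      moreover have "prob_in_coset N Y (real_vec 0) ?L' = 1"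
        using periods by (force simp: coset_iff real_vec_zero)
      ultimately have "z \<in> ?L'" using minimal z by blast
      then obtain k :: int where "(\<theta> \<bullet> z) / (2 * pi) = of_int k" by (auto elim: Ints_cases)
      then show ?thesis by (intro exI[of _ k]) (simp add: field_simps)
    qed
  qed

  let ?Q = "pos_def_sqrt \<Sigma>"
  let ?S = "matrix_inv ?Q"
  let ?loc = "\<lambda>n w. ((1 / sqrt (ln (real n))) *\<^sub>R (real_vec w - ln (real n) *\<^sub>R \<mu>)) v* ?S"
  note Q = pos_def_sqrt[OF moment(2)]
  have init: "\<And>v. 0 \<le> U0 v" "(\<Sum>v | U0 v \<noteq> 0. U0 v) = 1"
    using urn.initial by (auto simp: initial_configuration_def)
  have support: "real_vec v \<in> L" if "urn.color_law n v \<noteq> 0" for n v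
    using urn.color_law_support[OF step.finite_B step.p_support, of "{v. real_vec v \<in> L}" n v] that start steps L(2)
    by (simp add: real_vec_add)
  obtain \<epsilon> where \<epsilon>: "\<epsilon> \<longlonglongrightarrow> 0"
    "\<And>n w. n \<ge> 2 \<Longrightarrow> real_vec w \<in> L \<Longrightarrow>
      \<bar>det ?Q * sqrt (ln (real n)) ^ CARD('d) / \<bar>det D\<bar> * urn.color_law n w - std_gaussian_density (?loc n w)\<bar> \<le> \<epsilon> n"
  proof (rule step.lattice_local_limit[where q = urn.color_law and init = U0 and Q = ?Q])
    show "finite {v. urn.color_law n v \<noteq> 0}" for n
      using urn.color_law_finite_support_char_fun[OF step.finite_B step.p_support] by blast
    show "char_fun (urn.color_law n) \<theta> = char_fun U0 \<theta> * urn_product n (char_fun p \<theta>)" for n \<theta>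
      using urn.color_law_finite_support_char_fun[OF step.finite_B step.p_support] by blast
  qed (use init support Q in blast)+

  let ?err = "\<lambda>n x. \<bar>det ?Q * sqrt (ln (real n)) ^ CARD('d) / l
      * measure M {\<omega> \<in> space M. ?loc n (Z n \<omega>) = x} - std_gaussian_density x\<bar>"
  have err: "?err n x \<le> \<epsilon> n" if n: "n \<ge> 2" and x: "x \<in> scaled_lattice L x0 \<mu> ?S n" for n x
  proof -
    define r where "r = sqrt (ln (real n))"
    have r: "r > 0" "ln (real n) = r * r" using n by (simp_all add: r_def)
    obtain z where z: "z \<in> L" "x = (real n / r) *\<^sub>R (x0 v* ?S) - r *\<^sub>R (\<mu> v* ?S) + (1 / r) *\<^sub>R (z v* ?S)"
      using x by (auto simp: scaled_lattice_def r_def)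
    have "real n *\<^sub>R x0 + z \<in> L" by (intro L(2) nx0 z)
    with L_int obtain w where w: "real n *\<^sub>R x0 + z = real_vec w" by blast
    have x_loc: "x = ?loc n w"
      unfolding z(2) w[symmetric] r_def[symmetric] r(2) transpose_matrix_vector[symmetric]
      using r(1) by (simp add: matrix_vector_right_distrib matrix_vector_mult_diff_distrib
          matrix_vector_mult_scaleR algebra_simps)
    have inj: "?loc n v = ?loc n w \<longleftrightarrow> v = w" for v
    proof
      assume "?loc n v = ?loc n w"
      then have "?loc n v v* ?Q = ?loc n w v* ?Q" by simp
      then show "v = w"
        using r(1) matrix_inv_inverse(2)[OF pos_def_invertible[OF Q(1)]]
        by (simp add: vector_matrix_mul_assoc r_def[symmetric] real_vec_eq_iff)
    qed simp
    have "measure M {\<omega> \<in> space M. ?loc n (Z n \<omega>) = x} = urn.color_law n w"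
      unfolding x_loc inj by (simp add: urn.color_law_def)
    then show ?thesis
      using \<epsilon>(2)[OF n, of w] \<open>real n *\<^sub>R x0 + z \<in> L\<close> by (simp add: w l x_loc[symmetric])
  qed
  show ?thesis
  proof (rule Lim_null_comparison[OF _ \<epsilon>(1)])
    show "\<forall>\<^sub>F n in sequentially. norm (SUP x \<in> scaled_lattice L x0 \<mu> ?S n. ?err n x) \<le> \<epsilon> n"
      using eventually_ge_at_top[of 2]
    proof eventually_elim
      case (elim n)
      let ?A = "scaled_lattice L x0 \<mu> ?S n"
      have "?A \<noteq> {}" using L(1) by (auto simp: scaled_lattice_def)
      then obtain a where a: "a \<in> ?A" by blast
      have "bdd_above (?err n ` ?A)" using err[OF elim] by (intro bdd_aboveI2)
      then have "0 \<le> (SUP x \<in> ?A. ?err n x)"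
        by (rule cSUP_upper2[OF _ a]) simp
      moreover have "(SUP x \<in> ?A. ?err n x) \<le> \<epsilon> n"
        using \<open>?A \<noteq> {}\<close> err[OF elim] by (intro cSUP_least)
      ultimately show ?case by simp
    qed
  qed
qed


end
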